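(* Assume in addition $J\in L^2(\mathbb{R}^N)$. Let $\beta$ be defined by $$\beta=\inf\Big\{\frac{\int_\Omega\int_\Omega J(x-y)(u(y)-u(x))^2\,dy\,dx}{\int_\Omega(u(x)-\langle u\rangle)^2\,dx}:\ u\in L^2(\Omega)\ \text{not a.e. constant}\Big\},$$ where $\langle u\rangle=|\Omega|^{-1}\int_\Omega u$; then $\beta>0$. For every $u_0\in L^2(\Omega)$ the solution $u$ of (N) with $g\equiv0$ and $u(\cdot,0)=u_0$ satisfies, for all $t\ge0$, $$\|u(\cdot,t)-\langle u_0\rangle\|_{L^2(\Omega)}^2\le e^{-\beta t}\|u_0-\langle u_0\rangle\|_{L^2(\Omega)}^2.$$
   Context: Standing assumptions: $\Omega\subset\mathbb{R}^N$ bounded, connected, smooth; $J\ge0$ symmetric, $\int J=1$, $J=0$ outside $B(0,d)$, $\inf_{B(0,\rho)}J>0$ for every $\rho<d$. Problem (N): $u_t(x,t)=\int_\Omega J(x-y)(u(y,t)-u(x,t))dy+\int_{\mathbb{R}^N\setminus\Omega}J(x-y)g(y,t)dy$ for $x\in\Omega$, $t>0$. *)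

theory Defs
  imports "HOL-Analysis.Analysis"
begin

coinductive smooth_fun :: "('a::euclidean_space \<Rightarrow> real) \<Rightarrow> bool" where
  "(\<forall>x. f differentiable (at x)) \<Longrightarrow>
   (\<forall>v\<in>Basis. smooth_fun (\<lambda>x. frechet_derivative f (at x) v)) \<Longrightarrow> smooth_fun f"

text \<open>Bounded connected open set with smooth boundary, given by a global smooth
  defining function with non-vanishing gradient on its zero set.\<close>
definition smooth_bounded_domain :: "'a::euclidean_space set \<Rightarrow> bool" where
  "smooth_bounded_domain \<Omega> \<longleftrightarrow> bounded \<Omega> \<and> connected \<Omega> \<and> \<Omega> \<noteq> {} \<and>
     (\<exists>\<phi>. smooth_fun \<phi> \<and> \<Omega> = {x. \<phi> x < 0} \<and>
        (\<forall>x. \<phi> x = 0 \<longrightarrow> frechet_derivative \<phi> (at x) \<noteq> (\<lambda>v. 0)))"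

definition kernel_J :: "('a::euclidean_space \<Rightarrow> real) \<Rightarrow> real \<Rightarrow> bool" where
  "kernel_J J d \<longleftrightarrow> J \<in> borel_measurable lebesgue \<and> (\<forall>x. 0 \<le> J x) \<and> (\<forall>x. J (- x) = J x) \<and>
     integrable lebesgue J \<and> integral\<^sup>L lebesgue J = 1 \<and>
     (\<forall>x. x \<notin> ball 0 d \<longrightarrow> J x = 0) \<and>
     (\<forall>\<rho><d. \<exists>c>0. \<forall>x\<in>ball 0 \<rho>. c \<le> J x)"

definition L2_on :: "'a::euclidean_space set \<Rightarrow> ('a \<Rightarrow> real) \<Rightarrow> bool" where
  "L2_on \<Omega> u \<longleftrightarrow> u \<in> borel_measurable (lebesgue_on \<Omega>) \<and> integrable (lebesgue_on \<Omega>) (\<lambda>x. (u x)\<^sup>2)"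

definition mean_on :: "'a::euclidean_space set \<Rightarrow> ('a \<Rightarrow> real) \<Rightarrow> real" where
  "mean_on \<Omega> u = (LINT x|lebesgue_on \<Omega>. u x) / measure lebesgue \<Omega>"

definition nl_beta :: "('a::euclidean_space \<Rightarrow> real) \<Rightarrow> 'a set \<Rightarrow> real" where
  "nl_beta J \<Omega> = Inf {(LINT x|lebesgue_on \<Omega>. (LINT y|lebesgue_on \<Omega>. J (x - y) * (u y - u x)\<^sup>2)) /
                        (LINT x|lebesgue_on \<Omega>. (u x - mean_on \<Omega> u)\<^sup>2) | u.
                        L2_on \<Omega> u \<and> \<not> (\<exists>c. AE x in lebesgue_on \<Omega>. u x = c)}"

text \<open>Solution of (N) with g = 0 and initial datum u0, in integral (mild) form:
  u in C([0,oo); L2(Omega)), jointly measurable, and for every t >= 0, for a.e. x in Omega,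
  u(x,t) = u0(x) + int_0^t int_Omega J(x-y)(u(y,s)-u(x,s)) dy ds (all integrals existing).\<close>
definition nl_solution :: "('a::euclidean_space \<Rightarrow> real) \<Rightarrow> 'a set \<Rightarrow> ('a \<Rightarrow> real) \<Rightarrow> (real \<Rightarrow> 'a \<Rightarrow> real) \<Rightarrow> bool" where
  "nl_solution J \<Omega> u0 u \<longleftrightarrow>
     (\<forall>t\<ge>0. L2_on \<Omega> (u t)) \<and>
     (\<forall>t\<ge>0. ((\<lambda>s. LINT x|lebesgue_on \<Omega>. (u s x - u t x)\<^sup>2) \<longlongrightarrow> 0) (at t within {0..})) \<and>
     (\<lambda>p. u (fst p) (snd p)) \<in> borel_measurable (lebesgue_on ({0..} \<times> \<Omega>)) \<and>
     (\<forall>t\<ge>0. AE x in lebesgue_on \<Omega>.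
        (\<forall>s\<in>{0..t}. integrable (lebesgue_on \<Omega>) (\<lambda>y. J (x - y) * (u s y - u s x))) \<and>
        set_integrable lborel {0..t} (\<lambda>s. LINT y|lebesgue_on \<Omega>. J (x - y) * (u s y - u s x)) \<and>
        u t x = u0 x + (LINT s:{0..t}|lborel. (LINT y|lebesgue_on \<Omega>. J (x - y) * (u s y - u s x))))"

end

theory Submission
  imports Defs
begin

text \<open>The operator \<open>A f x = \<integral> J (x - y) (f y - f x) dy\<close> is bounded on \<open>L\<^sup>2\<close> (because \<open>J\<close> has mass one)
  and symmetric, with \<open>\<langle>A f, g\<rangle> = - form f g / 2\<close> and \<open>form f f\<close> the numerator in the definition of \<open>\<beta>\<close>.
  Pairing the mild equation with a fixed \<open>g\<close> shows that \<open>\<langle>u t, g\<rangle>\<close> is continuously differentiable, so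
  the mean is conserved and \<open>\<parallel>u t - c\<parallel>\<^sup>2\<close> has derivative \<open>- form (u t) (u t)\<close>; the defining inequality
  of \<open>\<beta>\<close> then makes \<open>exp (\<beta> t) \<parallel>u t - c\<parallel>\<^sup>2\<close> nonincreasing.

  Positivity of \<open>\<beta>\<close> is a Poincare inequality. Since \<open>J\<close> is bounded below near the origin, \<open>form f f\<close>
  controls the oscillation of \<open>f\<close> on small balls and between overlapping ones; chains of such balls
  connect the whole domain, and finitely many of them cover it.\<close>

subsection \<open>Square-integrable functions\<close>

text \<open>The right-hand side of \<open>bound\<close> is smallest at a = sqrt (Q / P). If P or Q
  vanishes, the infimum may be reached only as a tends to infinity or to 0, so the proof works with
  a slack e.\<close>

lemma AM_GM_bound_imp_le_sqrt:
  fixes X P Q :: real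
  assumes "0 \<le> P" "0 \<le> Q" and bound: "\<And>a. 0 < a \<Longrightarrow> X \<le> a * P + Q / a"
  shows "X \<le> 2 * sqrt (P * Q)"
proof -
  have "X \<le> 2 * sqrt (P * Q) + e" if "0 < e" for e
  proof (cases "P = 0 \<or> Q = 0")
    case True
    then show ?thesis
    proof
      assume "P = 0"
      \<comment> \<open>This choice of a makes Q / a at most e; the added 1 keeps a positive when Q
        is 0 as well.\<close>
      moreover have "0 < (Q + 1) / e" "Q / ((Q + 1) / e) \<le> e"
        using assms that by (auto simp: field_simps)
      ultimately show ?thesis using bound[of "(Q + 1) / e"] by simp
    next
      assume "Q = 0"
      moreover have "0 < e / (P + 1)" "e / (P + 1) * P \<le> e"
        using assms that by (auto simp: field_simps)
      ultimately show ?thesis using bound[of "e / (P + 1)"] by simp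
    qed
  next
    case False
    then have PQ: "0 < P" "0 < Q" using assms by auto
    define p q where "p = sqrt P" and "q = sqrt Q"
    have "0 < p" "0 < q" "P = p * p" "Q = q * q"
      using PQ by (auto simp: p_def q_def)
    \<comment> \<open>At the minimiser a = q / p both terms of the bound equal p * q.\<close>
    then have "X \<le> 2 * (p * q)" "sqrt (P * Q) = p * q"
      using bound[of "q / p"] by (auto simp: real_sqrt_mult)
    then show ?thesis using that by simp
  qed
  then show ?thesis by (rule field_le_epsilon)
qed

lemma abs_mult_le_weighted:
  fixes x y a :: real
  assumes "0 < a"
  shows "\<bar>x * y\<bar> \<le> (a * x\<^sup>2 + y\<^sup>2 / a) / 2"
proof -
  have "0 \<le> (a * \<bar>x\<bar> - \<bar>y\<bar>)\<^sup>2 / a" using assms by simp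
  also have "\<dots> = a * x\<^sup>2 + y\<^sup>2 / a - 2 * \<bar>x * y\<bar>"
    using assms by (simp add: field_simps power2_eq_square abs_mult flip: abs_mult)
  finally show ?thesis by simp
qed

lemma sq_diff_le: "(x - y)\<^sup>2 \<le> 2 * x\<^sup>2 + 2 * (y::real)\<^sup>2"
  using zero_le_power2[of "x + y"] by (simp add: power2_eq_square algebra_simps)

text \<open>The counterpart of \<open>L2_on\<close> over an arbitrary measure, so that the analysis
  can run on an abstract finite measure space.\<close>

definition sq_int :: "'a measure \<Rightarrow> ('a \<Rightarrow> real) \<Rightarrow> bool" where
  "sq_int M f \<longleftrightarrow> f \<in> borel_measurable M \<and> integrable M (\<lambda>x. (f x)\<^sup>2)"

definition nsq :: "'a measure \<Rightarrow> ('a \<Rightarrow> real) \<Rightarrow> real" where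
  "nsq M f = (LINT x|M. (f x)\<^sup>2)"

lemma sq_intD:
  assumes "sq_int M f"
  shows sq_int_measurable: "f \<in> borel_measurable M" and sq_int_integrable: "integrable M (\<lambda>x. (f x)\<^sup>2)"
  using assms by (auto simp: sq_int_def)

lemma nsq_nonneg [simp]: "0 \<le> nsq M f"
  by (simp add: nsq_def)

lemma sq_int_diff:
  assumes f: "sq_int M f" and g: "sq_int M g"
  shows "sq_int M (\<lambda>x. f x - g x)"
proof -
  note [measurable] = sq_int_measurable[OF f] sq_int_measurable[OF g]
  have "integrable M (\<lambda>x. (f x - g x)\<^sup>2)"
  proof (rule Bochner_Integration.integrable_bound)
    show "integrable M (\<lambda>x. 2 * (f x)\<^sup>2 + 2 * (g x)\<^sup>2)"
      using sq_intD[OF f] sq_intD[OF g] by simp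
    show "AE x in M. norm ((f x - g x)\<^sup>2) \<le> norm (2 * (f x)\<^sup>2 + 2 * (g x)\<^sup>2)"
      using sq_diff_le by (simp add: abs_of_nonneg)
  qed measurable
  then show ?thesis by (simp add: sq_int_def)
qed

lemma sq_int_mult_integrable:
  assumes f: "sq_int M f" and g: "sq_int M g"
  shows "integrable M (\<lambda>x. f x * g x)"
proof -
  note [measurable] = sq_int_measurable[OF f] sq_int_measurable[OF g]
  show ?thesis
  proof (rule Bochner_Integration.integrable_bound)
    show "integrable M (\<lambda>x. (f x)\<^sup>2 + (g x)\<^sup>2)"
      using sq_intD[OF f] sq_intD[OF g] by simp
    have "\<bar>f x * g x\<bar> \<le> \<bar>(f x)\<^sup>2 + (g x)\<^sup>2\<bar>" for x
      using abs_mult_le_weighted[of 1 "f x" "g x", simplified] zero_le_power2[of "f x"] zero_le_power2[of "g x"]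
      by linarith
    then show "AE x in M. norm (f x * g x) \<le> norm ((f x)\<^sup>2 + (g x)\<^sup>2)" by simp
  qed measurable
qed

text \<open>Integrating the weighted inequality gives a bound for every weight a, and optimising a
  turns it into the product of the norms. The factor 2 kept on the left cancels the one that the
  optimisation produces.\<close>

lemma Cauchy_Schwarz_sq_int:
  assumes f: "sq_int M f" and g: "sq_int M g"
  shows "\<bar>LINT x|M. f x * g x\<bar> \<le> sqrt (nsq M f * nsq M g)"
proof -
  have "2 * \<bar>LINT x|M. f x * g x\<bar> \<le> a * nsq M f + nsq M g / a" if "0 < a" for a
  proof -
    have "\<bar>LINT x|M. f x * g x\<bar> \<le> (LINT x|M. \<bar>f x * g x\<bar>)"
      by (rule integral_abs_bound)
    also have "\<dots> \<le> (LINT x|M. (a * (f x)\<^sup>2 + (g x)\<^sup>2 / a) / 2)"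
      using sq_intD[OF f] sq_intD[OF g] that
      by (intro integral_mono abs_mult_le_weighted integrable_abs sq_int_mult_integrable f g) auto
    also have "\<dots> = (a * nsq M f + nsq M g / a) / 2"
      using sq_intD[OF f] sq_intD[OF g] by (simp add: nsq_def)
    finally show ?thesis by simp
  qed
  from AM_GM_bound_imp_le_sqrt[OF _ _ this] show ?thesis by simp
qed

text \<open>Writing f as g + (f - g) splits the squared norm into a part linear in the increment and
  a quadratic remainder. With g fixed in time, continuity and the time derivative of the norm are
  read off from these two parts.\<close>

lemma nsq_diff_expand:
  assumes f: "sq_int M f" and g: "sq_int M g"
  shows "nsq M f = nsq M g + 2 * (LINT x|M. (f x - g x) * g x) + nsq M (\<lambda>x. f x - g x)"
proof -
  note d = sq_int_diff[OF f g]
  have "nsq M f = (LINT x|M. (g x)\<^sup>2 + 2 * ((f x - g x) * g x) + (f x - g x)\<^sup>2)"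
    unfolding nsq_def
    by (rule Bochner_Integration.integral_cong) (auto simp: power2_eq_square algebra_simps)
  also have "\<dots> = nsq M g + 2 * (LINT x|M. (f x - g x) * g x) + nsq M (\<lambda>x. f x - g x)"
    using sq_intD[OF f] sq_intD[OF g] sq_intD[OF d] sq_int_mult_integrable[OF d g]
    by (simp add: nsq_def)
  finally show ?thesis .
qed

lemma (in finite_measure) sq_int_const: "sq_int M (\<lambda>_. c)"
  by (simp add: sq_int_def)

lemma (in finite_measure) sq_int_imp_integrable:
  assumes "sq_int M f" shows "integrable M f"
  using sq_int_mult_integrable[OF assms sq_int_const[of 1]] by simp

subsection \<open>The nonlocal quadratic form\<close>

text \<open>The mass is bounded by 1 rather than equal to 1, because integrating over the domain
  loses the part of \<open>J (x - y)\<close> that lies outside.\<close>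

locale nonlocal_kernel = finite_measure M for M :: "'a measure" +
  fixes k :: "'a \<Rightarrow> 'a \<Rightarrow> real"
  assumes k_measurable [measurable]: "case_prod k \<in> borel_measurable (M \<Otimes>\<^sub>M M)"
    and k_nonneg: "0 \<le> k x y"
    and k_sym: "k x y = k y x"
    and k_mass: "x \<in> space M \<Longrightarrow> (\<integral>\<^sup>+y. ennreal (k x y) \<partial>M) \<le> 1"
begin

sublocale MM: pair_sigma_finite M M ..

definition nl_op :: "('a \<Rightarrow> real) \<Rightarrow> 'a \<Rightarrow> real" where
  "nl_op f x = (LINT y|M. k x y * (f y - f x))"

text \<open>Taken over the product measure, so that Fubini and the exchange of x and y apply
  directly. Without a factor 1/2, \<open>form f f\<close> is exactly the numerator of the quotient
  defining \<beta>.\<close>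

definition form :: "('a \<Rightarrow> real) \<Rightarrow> ('a \<Rightarrow> real) \<Rightarrow> real" where
  "form f g = (LINT (x, y)|(M \<Otimes>\<^sub>M M). k x y * ((f y - f x) * (g y - g x)))"

text \<open>By Tonelli the integral over y can be done first, at the cost of a factor at most 1. All
  the bounds of the form in terms of squared norms go back to this.\<close>

lemma
  assumes f: "sq_int M f"
  shows integrable_k_sq_fst: "integrable (M \<Otimes>\<^sub>M M) (\<lambda>(x, y). k x y * (f x)\<^sup>2)"
    and integral_k_sq_fst: "(LINT (x, y)|(M \<Otimes>\<^sub>M M). k x y * (f x)\<^sup>2) \<le> nsq M f"
proof -
  note [measurable] = sq_int_measurable[OF f]
  have "(\<integral>\<^sup>+p. ennreal (case p of (x, y) \<Rightarrow> k x y * (f x)\<^sup>2) \<partial>(M \<Otimes>\<^sub>M M)) =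
      (\<integral>\<^sup>+x. \<integral>\<^sup>+y. ennreal (k x y * (f x)\<^sup>2) \<partial>M \<partial>M)"
    by (subst nn_integral_fst[symmetric]) auto
  also have "\<dots> = (\<integral>\<^sup>+x. (\<integral>\<^sup>+y. ennreal (k x y) \<partial>M) * ennreal ((f x)\<^sup>2) \<partial>M)"
    by (intro nn_integral_cong) (simp add: ennreal_mult k_nonneg nn_integral_multc)
  also have "\<dots> \<le> (\<integral>\<^sup>+x. ennreal ((f x)\<^sup>2) \<partial>M)"
    using mult_right_mono[OF k_mass] by (intro nn_integral_mono) fastforce
  also have "\<dots> = ennreal (nsq M f)"
    unfolding nsq_def by (intro nn_integral_eq_integral sq_int_integrable f) auto
  finally have le: "(\<integral>\<^sup>+p. ennreal (case p of (x, y) \<Rightarrow> k x y * (f x)\<^sup>2) \<partial>(M \<Otimes>\<^sub>M M)) \<le> ennreal (nsq M f)" .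
  show int: "integrable (M \<Otimes>\<^sub>M M) (\<lambda>(x, y). k x y * (f x)\<^sup>2)"
    using le by (intro integrableI_bounded)
      (auto simp: k_nonneg abs_mult split_beta' order_le_less_trans)
  have "ennreal (LINT (x, y)|(M \<Otimes>\<^sub>M M). k x y * (f x)\<^sup>2) \<le> ennreal (nsq M f)"
    using le by (subst nn_integral_eq_integral[symmetric, OF int]) (auto simp: k_nonneg)
  then show "(LINT (x, y)|(M \<Otimes>\<^sub>M M). k x y * (f x)\<^sup>2) \<le> nsq M f"
    by simp
qed

lemma
  assumes f: "sq_int M f"
  shows integrable_k_sq_snd: "integrable (M \<Otimes>\<^sub>M M) (\<lambda>(x, y). k x y * (f y)\<^sup>2)"
    and integral_k_sq_snd: "(LINT (x, y)|(M \<Otimes>\<^sub>M M). k x y * (f y)\<^sup>2) \<le> nsq M f"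
proof -
  note [measurable] = sq_int_measurable[OF f]
  show "integrable (M \<Otimes>\<^sub>M M) (\<lambda>(x, y). k x y * (f y)\<^sup>2)"
    using MM.integrable_product_swap[OF integrable_k_sq_fst[OF f]] by (simp add: k_sym)
  show "(LINT (x, y)|(M \<Otimes>\<^sub>M M). k x y * (f y)\<^sup>2) \<le> nsq M f"
    using MM.integral_product_swap[OF borel_measurable_integrable[OF integrable_k_sq_fst[OF f]]]
      integral_k_sq_fst[OF f] by (simp add: k_sym)
qed

text \<open>The bilinear integrands below are dominated by k times the squares of f and g at the two
  points, and the two preceding lemmas control each such product. The weights a and b stay free so
  that they can be chosen afterwards.\<close>

lemma integrable_k_bound:
  assumes f: "sq_int M f" and g: "sq_int M g"
    and [measurable]: "case_prod h \<in> borel_measurable (M \<Otimes>\<^sub>M M)"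
    and h: "\<And>x y. \<bar>h x y\<bar> \<le> k x y * (a * ((f x)\<^sup>2 + (f y)\<^sup>2) + b * ((g x)\<^sup>2 + (g y)\<^sup>2))"
  shows "integrable (M \<Otimes>\<^sub>M M) (case_prod h)"
    and "0 \<le> a \<Longrightarrow> 0 \<le> b \<Longrightarrow> (LINT (x, y)|(M \<Otimes>\<^sub>M M). \<bar>h x y\<bar>) \<le> 2 * (a * nsq M f + b * nsq M g)"
proof -
  let ?fx = "\<lambda>(x, y). k x y * (f x)\<^sup>2" and ?fy = "\<lambda>(x, y). k x y * (f y)\<^sup>2"
    and ?gx = "\<lambda>(x, y). k x y * (g x)\<^sup>2" and ?gy = "\<lambda>(x, y). k x y * (g y)\<^sup>2"
  let ?B = "\<lambda>p. a * (?fx p + ?fy p) + b * (?gx p + ?gy p)"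
  note ints = integrable_k_sq_fst[OF f] integrable_k_sq_snd[OF f]
    integrable_k_sq_fst[OF g] integrable_k_sq_snd[OF g]
  have B: "integrable (M \<Otimes>\<^sub>M M) ?B"
    by (intro Bochner_Integration.integrable_add integrable_mult_right ints)
  have hB: "\<bar>case_prod h p\<bar> \<le> ?B p" for p
    using h[of "fst p" "snd p"] by (simp add: split_beta algebra_simps)
  show int: "integrable (M \<Otimes>\<^sub>M M) (case_prod h)"
  proof (rule Bochner_Integration.integrable_bound[OF B])
    show "AE p in M \<Otimes>\<^sub>M M. norm (case_prod h p) \<le> norm (?B p)"
      using hB by (intro AE_I2) (smt (verit) real_norm_def)
  qed measurable
  assume ab: "0 \<le> a" "0 \<le> b"
  have "(LINT (x, y)|(M \<Otimes>\<^sub>M M). \<bar>h x y\<bar>) = (LINT p|(M \<Otimes>\<^sub>M M). \<bar>case_prod h p\<bar>)"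
    by (simp add: split_beta')
  also have "\<dots> \<le> (LINT p|(M \<Otimes>\<^sub>M M). ?B p)"
    using int B hB by (intro integral_mono) auto
  also have "\<dots> = a * (integral\<^sup>L (M \<Otimes>\<^sub>M M) ?fx + integral\<^sup>L (M \<Otimes>\<^sub>M M) ?fy)
      + b * (integral\<^sup>L (M \<Otimes>\<^sub>M M) ?gx + integral\<^sup>L (M \<Otimes>\<^sub>M M) ?gy)"
    using ints by (simp del: split_beta)
  also have "\<dots> \<le> a * (nsq M f + nsq M f) + b * (nsq M g + nsq M g)"
    by (intro add_mono mult_left_mono ab integral_k_sq_fst integral_k_sq_snd f g)
  finally show "(LINT (x, y)|(M \<Otimes>\<^sub>M M). \<bar>h x y\<bar>) \<le> 2 * (a * nsq M f + b * nsq M g)"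
    by (simp add: algebra_simps)
qed

lemma k_product_bound:
  assumes "0 < a"
  shows "\<bar>k x y * ((f y - f x) * (g y - g x))\<bar>
    \<le> k x y * (a * ((f x)\<^sup>2 + (f y)\<^sup>2) + (1 / a) * ((g x)\<^sup>2 + (g y)\<^sup>2))"
proof -
  have "\<bar>(f y - f x) * (g y - g x)\<bar> \<le> (a * (f y - f x)\<^sup>2 + (g y - g x)\<^sup>2 / a) / 2"
    by (rule abs_mult_le_weighted[OF assms])
  also have "\<dots> \<le> (a * (2 * (f y)\<^sup>2 + 2 * (f x)\<^sup>2) + (2 * (g y)\<^sup>2 + 2 * (g x)\<^sup>2) / a) / 2"
    using assms by (intro divide_right_mono add_mono mult_left_mono sq_diff_le) auto
  also have "\<dots> = a * ((f x)\<^sup>2 + (f y)\<^sup>2) + (1 / a) * ((g x)\<^sup>2 + (g y)\<^sup>2)"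
    using assms by (simp add: field_simps)
  finally have "k x y * \<bar>(f y - f x) * (g y - g x)\<bar>
      \<le> k x y * (a * ((f x)\<^sup>2 + (f y)\<^sup>2) + (1 / a) * ((g x)\<^sup>2 + (g y)\<^sup>2))"
    by (rule mult_left_mono) (rule k_nonneg)
  then show ?thesis
    by (simp only: abs_mult[of "k x y"] abs_of_nonneg[OF k_nonneg])
qed

lemma form_integrable:
  assumes f: "sq_int M f" and g: "sq_int M g"
  shows "integrable (M \<Otimes>\<^sub>M M) (\<lambda>(x, y). k x y * ((f y - f x) * (g y - g x)))"
proof -
  note [measurable] = sq_int_measurable[OF f] sq_int_measurable[OF g]
  show ?thesis
    by (rule integrable_k_bound(1)[OF f g, where a = 1 and b = 1])
      (use k_product_bound[of 1] in auto)
qed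

text \<open>\<open>k_product_bound\<close> bounds half of the left side by a * P + Q / a for every
  a, with P and Q the squared norms; optimising a supplies the other factor 2.\<close>

lemma form_bound:
  assumes f: "sq_int M f" and g: "sq_int M g"
  shows "\<bar>form f g\<bar> \<le> 4 * sqrt (nsq M f * nsq M g)"
proof -
  note [measurable] = sq_int_measurable[OF f] sq_int_measurable[OF g]
  have "\<bar>form f g\<bar> / 2 \<le> a * nsq M f + nsq M g / a" if "0 < a" for a
  proof -
    have "\<bar>form f g\<bar> \<le> (LINT (x, y)|(M \<Otimes>\<^sub>M M). \<bar>k x y * ((f y - f x) * (g y - g x))\<bar>)"
      unfolding form_def split_beta by (rule integral_abs_bound)
    also have "\<dots> \<le> 2 * (a * nsq M f + 1 / a * nsq M g)"
      by (rule integrable_k_bound(2)[OF f g]) (use k_product_bound[OF that] that in auto)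
    finally show ?thesis by (simp add: algebra_simps)
  qed
  from AM_GM_bound_imp_le_sqrt[OF _ _ this] show ?thesis by simp
qed

lemma form_nonneg: "0 \<le> form f f"
  unfolding form_def by (intro integral_nonneg_AE AE_I2) (auto simp: k_nonneg)

lemma form_iterated:
  assumes f: "sq_int M f" and g: "sq_int M g"
  shows "form f g = (LINT x|M. LINT y|M. k x y * ((f y - f x) * (g y - g x)))"
  unfolding form_def using MM.integral_fst'[OF form_integrable[OF f g]] by simp

lemma form_diff_left:
  assumes f: "sq_int M f" and g: "sq_int M g" and h: "sq_int M h"
  shows "form (\<lambda>x. f x - g x) h = form f h - form g h"
proof -
  have "form f h - form g h = (LINT p|(M \<Otimes>\<^sub>M M).
      (\<lambda>(x, y). k x y * ((f y - f x) * (h y - h x))) p - (\<lambda>(x, y). k x y * ((g y - g x) * (h y - h x))) p)"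
    unfolding form_def
    by (rule Bochner_Integration.integral_diff[symmetric] form_integrable f g h)+
  also have "\<dots> = form (\<lambda>x. f x - g x) h"
    unfolding form_def by (rule Bochner_Integration.integral_cong) (auto simp: algebra_simps)
  finally show ?thesis ..
qed

lemma form_shift: "form f (\<lambda>x. g x - c) = form f g"
  by (simp add: form_def)

lemma nl_op_measurable:
  assumes [measurable]: "case_prod f \<in> borel_measurable (N \<Otimes>\<^sub>M M)"
  shows "(\<lambda>(s, x). nl_op (f s) x) \<in> borel_measurable (N \<Otimes>\<^sub>M M)"
  unfolding nl_op_def by measurable

text \<open>Exchanging x and y turns \<open>k x y * ((f y - f x) * g x)\<close> into
  \<open>- k x y * ((f y - f x) * g y)\<close>; averaging the two gives a nonlocal Green formula.
  The bound on the absolute value prepares the use of Fubini in time and space.\<close>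

lemma
  assumes f: "sq_int M f" and g: "sq_int M g"
  shows nl_op_mult_integrable: "integrable M (\<lambda>x. nl_op f x * g x)"
    and integral_nl_op_mult: "(LINT x|M. nl_op f x * g x) = - form f g / 2"
    and integral_abs_nl_op_mult: "(LINT x|M. \<bar>nl_op f x * g x\<bar>) \<le> 2 * (nsq M f + nsq M g)"
proof -
  note [measurable] = sq_int_measurable[OF f] sq_int_measurable[OF g]
  let ?h = "\<lambda>x y. k x y * ((f y - f x) * g x)"
  have bound: "\<bar>?h x y\<bar> \<le> k x y * (1 * ((f x)\<^sup>2 + (f y)\<^sup>2) + 1 * ((g x)\<^sup>2 + (g y)\<^sup>2))" for x y
  proof -
    have "\<bar>(f y - f x) * g x\<bar> \<le> ((f y - f x)\<^sup>2 + (g x)\<^sup>2) / 2"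
      using abs_mult_le_weighted[of 1 "f y - f x" "g x"] by simp
    also have "\<dots> \<le> (f x)\<^sup>2 + (f y)\<^sup>2 + ((g x)\<^sup>2 + (g y)\<^sup>2)"
      using sq_diff_le[of "f y" "f x"] zero_le_power2[of "g x"] zero_le_power2[of "g y"] by argo
    finally show ?thesis
      using mult_left_mono[OF _ k_nonneg[of x y]] by (simp add: abs_mult k_nonneg)
  qed
  have h: "integrable (M \<Otimes>\<^sub>M M) (case_prod ?h)"
    by (rule integrable_k_bound(1)[OF f g _ bound]) measurable
  have op: "nl_op f x * g x = (LINT y|M. ?h x y)" for x
    by (simp add: nl_op_def flip: mult.assoc)
  show int: "integrable M (\<lambda>x. nl_op f x * g x)"
    using MM.integrable_fst'[OF h] by (simp add: op)
  have swap: "integrable (M \<Otimes>\<^sub>M M) (\<lambda>(x, y). ?h y x)"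
    using MM.integrable_product_swap[OF h] by simp
  have eq: "(LINT x|M. nl_op f x * g x) = integral\<^sup>L (M \<Otimes>\<^sub>M M) (case_prod ?h)"
    using MM.integral_fst'[OF h] by (simp add: op)
  have eq': "(LINT x|M. nl_op f x * g x) = (LINT (x, y)|(M \<Otimes>\<^sub>M M). ?h y x)"
    using MM.integral_product_swap[OF borel_measurable_integrable[OF h]] by (simp add: eq)
  have "(LINT x|M. nl_op f x * g x) * 2
      = (LINT p|(M \<Otimes>\<^sub>M M). case_prod ?h p + (\<lambda>(x, y). ?h y x) p)"
    using h swap eq eq' by (subst Bochner_Integration.integral_add) auto
  also have "\<dots> = (LINT p|(M \<Otimes>\<^sub>M M). - (\<lambda>(x, y). k x y * ((f y - f x) * (g y - g x))) p)"
  proof (rule Bochner_Integration.integral_cong[OF refl])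
    fix p
    show "case_prod ?h p + (\<lambda>(x, y). ?h y x) p = - (\<lambda>(x, y). k x y * ((f y - f x) * (g y - g x))) p"
      using k_sym[of "fst p" "snd p"] by (simp add: split_beta algebra_simps)
  qed
  also have "\<dots> = - form f g"
    unfolding form_def by (rule integral_minus)
  finally show "(LINT x|M. nl_op f x * g x) = - form f g / 2" by simp
  have habs: "integrable (M \<Otimes>\<^sub>M M) (\<lambda>(x, y). \<bar>?h x y\<bar>)"
    using integrable_abs[OF h] by (simp add: split_beta')
  have "(LINT x|M. \<bar>nl_op f x * g x\<bar>) \<le> (LINT x|M. LINT y|M. \<bar>?h x y\<bar>)"
    using int MM.integrable_fst'[OF habs]
    by (intro integral_mono) (auto simp: op integral_abs_bound)
  also have "\<dots> = (LINT (x, y)|(M \<Otimes>\<^sub>M M). \<bar>?h x y\<bar>)"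
    using MM.integral_fst'[OF habs] by simp
  also have "\<dots> \<le> 2 * (1 * nsq M f + 1 * nsq M g)"
    by (rule integrable_k_bound(2)[OF f g _ bound]) auto
  finally show "(LINT x|M. \<bar>nl_op f x * g x\<bar>) \<le> 2 * (nsq M f + nsq M g)" by simp
qed

text \<open>The operator sees f through an integral and also through the single value f x, so
  equality almost everywhere is supplemented by equality at x.\<close>

lemma nl_op_cong_AE:
  assumes [measurable]: "f \<in> borel_measurable M" "g \<in> borel_measurable M"
    and fg: "AE y in M. f y = g y" and x: "x \<in> space M" "f x = g x"
  shows "nl_op f x = nl_op g x"
proof -
  have [measurable]: "k x \<in> borel_measurable M"
    using measurable_compose[OF measurable_Pair1'[OF x(1)] k_measurable] by simp
  show ?thesis
    unfolding nl_op_def by (rule integral_cong_AE) (use fg x in \<open>auto elim: AE_mp\<close>)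
qed

end

subsection \<open>The evolution\<close>

text \<open>Two copies of the solution: \<open>u\<close> has the L2 properties at every time, while
  \<open>v\<close> is measurable for the product sigma-algebra, as Fubini requires. They agree on
  almost every time slice, and the time integral in \<open>mild\<close> is taken over
  \<open>v\<close>.\<close>

locale nonlocal_evolution = nonlocal_kernel M k for M :: "'a measure" and k +
  fixes u v :: "real \<Rightarrow> 'a \<Rightarrow> real" and u0 :: "'a \<Rightarrow> real"
  assumes u0: "sq_int M u0"
    and u: "0 \<le> t \<Longrightarrow> sq_int M (u t)"
    and u_cont: "0 \<le> t \<Longrightarrow> ((\<lambda>s. nsq M (\<lambda>x. u s x - u t x)) \<longlongrightarrow> 0) (at t within {0..})"
    and v_measurable [measurable]: "case_prod v \<in> borel_measurable (lborel \<Otimes>\<^sub>M M)"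
    and u_eq_v: "AE s in lborel. 0 \<le> s \<longrightarrow> (AE x in M. u s x = v s x)"
    and mild: "0 \<le> t \<Longrightarrow> AE x in M. u t x = u0 x + (LINT s:{0..t}|lborel. nl_op (v s) x)"
begin

section \<open>Continuity in time of the norm and of the form against a fixed function\<close>

lemma tendsto_0_of_nsq_bound:
  assumes "0 \<le> t" and bound: "\<And>s. 0 \<le> s \<Longrightarrow> \<bar>h s\<bar> \<le> c * sqrt (nsq M (\<lambda>x. u s x - u t x) * d)"
  shows "(h \<longlongrightarrow> 0) (at t within {0..})"
proof (rule tendsto_0_le[where K = 1])
  show "((\<lambda>s. c * sqrt (nsq M (\<lambda>x. u s x - u t x) * d)) \<longlongrightarrow> 0) (at t within {0..})"
    by (auto intro!: tendsto_eq_intros u_cont assms(1))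
  show "\<forall>\<^sub>F s in at t within {0..}. norm (h s) \<le> norm (c * sqrt (nsq M (\<lambda>x. u s x - u t x) * d)) * 1"
    unfolding eventually_at_filter using bound by (intro always_eventually) fastforce
qed

lemma nsq_continuous: "continuous_on {0..} (\<lambda>t. nsq M (u t))"
  unfolding continuous_on_def
proof
  fix t :: real assume "t \<in> {0..}"
  then have t: "0 \<le> t" by simp
  have 1: "((\<lambda>s. LINT x|M. (u s x - u t x) * u t x) \<longlongrightarrow> 0) (at t within {0..})"
    by (rule tendsto_0_of_nsq_bound[OF t, where c = 1 and d = "nsq M (u t)"])
      (use Cauchy_Schwarz_sq_int[OF sq_int_diff[OF u u[OF t]] u[OF t]] in simp)
  have "((\<lambda>s. nsq M (u t) + 2 * (LINT x|M. (u s x - u t x) * u t x) + nsq M (\<lambda>x. u s x - u t x))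
      \<longlongrightarrow> nsq M (u t)) (at t within {0..})"
    by (auto intro!: tendsto_eq_intros 1 u_cont t)
  then show "((\<lambda>s. nsq M (u s)) \<longlongrightarrow> nsq M (u t)) (at t within {0..})"
    by (rule Lim_transform_within[OF _ zero_less_one]) (simp add: nsq_diff_expand[OF u u[OF t]])
qed

lemma nsq_bounded:
  obtains K where "0 \<le> K" "\<And>s. s \<in> {0..T} \<Longrightarrow> nsq M (u s) \<le> K"
proof -
  have "continuous_on {0..T} (\<lambda>t. nsq M (u t))"
    by (rule continuous_on_subset[OF nsq_continuous]) auto
  then have "bounded ((\<lambda>t. nsq M (u t)) ` {0..T})"
    by (intro compact_imp_bounded compact_continuous_image) auto
  then obtain K where "\<forall>y\<in>(\<lambda>t. nsq M (u t)) ` {0..T}. norm y \<le> K"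
    unfolding bounded_iff by blast
  then have "nsq M (u s) \<le> max 0 K" if "s \<in> {0..T}" for s
    using that by force
  then show ?thesis using that[of "max 0 K"] by simp
qed

lemma form_continuous:
  assumes g: "sq_int M g"
  shows "continuous_on {0..} (\<lambda>t. form (u t) g)"
  unfolding continuous_on_def
proof
  fix t :: real assume "t \<in> {0..}"
  then have t: "0 \<le> t" by simp
  have 1: "((\<lambda>s. form (\<lambda>x. u s x - u t x) g) \<longlongrightarrow> 0) (at t within {0..})"
    by (rule tendsto_0_of_nsq_bound[OF t, where c = 4 and d = "nsq M g"])
      (rule form_bound[OF sq_int_diff[OF u u[OF t]] g])
  have "((\<lambda>s. form (u t) g + form (\<lambda>x. u s x - u t x) g) \<longlongrightarrow> form (u t) g) (at t within {0..})"
    by (auto intro!: tendsto_eq_intros 1)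
  then show "((\<lambda>s. form (u s) g) \<longlongrightarrow> form (u t) g) (at t within {0..})"
    by (rule Lim_transform_within[OF _ zero_less_one]) (simp add: form_diff_left[OF u u[OF t] g])
qed

lemma half_form_continuous:
  assumes "sq_int M g" "0 \<le> a"
  shows "continuous_on {a..b} (\<lambda>s. - form (u s) g / 2)"
  using assms by (intro continuous_intros continuous_on_subset[OF form_continuous]) auto

text \<open>On almost every time slice \<open>v s\<close> is a modification of \<open>u s\<close> on
  a null set, so the estimates for \<open>nl_op (u s)\<close> carry over. The times range over the
  whole line, whereas \<open>u\<close> is constrained only for nonnegative ones.\<close>

lemma integral_nl_op_v:
  assumes g: "sq_int M g"
  shows "AE s in lborel. 0 \<le> s \<longrightarrow> integrable M (\<lambda>x. nl_op (v s) x * g x) \<and>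
    (LINT x|M. nl_op (v s) x * g x) = - form (u s) g / 2 \<and>
    (LINT x|M. \<bar>nl_op (v s) x * g x\<bar>) \<le> 2 * (nsq M (u s) + nsq M g)"
  using u_eq_v
proof eventually_elim
  case (elim s)
  show ?case
  proof
    assume s: "0 \<le> s"
    note [measurable] = sq_int_measurable[OF u[OF s]] sq_int_measurable[OF g]
    have [measurable]: "v s \<in> borel_measurable M"
      using measurable_compose[OF measurable_Pair1' v_measurable] by simp
    have eq: "AE x in M. u s x = v s x" using elim s by simp
    with AE_space have "AE x in M. nl_op (u s) x = nl_op (v s) x"
    proof eventually_elim
      case (elim x)
      show ?case by (rule nl_op_cong_AE[OF _ _ eq elim]) simp_all
    qed
    then have ae: "AE x in M. nl_op (u s) x * g x = nl_op (v s) x * g x" by auto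
    have [measurable]: "nl_op (u s) \<in> borel_measurable M" "nl_op (v s) \<in> borel_measurable M"
      unfolding nl_op_def by measurable
    have "integrable M (\<lambda>x. nl_op (v s) x * g x)"
      using ae by (rule integrable_cong_AE_imp[OF nl_op_mult_integrable[OF u[OF s] g], rotated]) measurable
    moreover have "(LINT x|M. nl_op (u s) x * g x) = (LINT x|M. nl_op (v s) x * g x)"
      by (rule integral_cong_AE[OF _ _ ae]) measurable
    moreover have "(LINT x|M. \<bar>nl_op (u s) x * g x\<bar>) = (LINT x|M. \<bar>nl_op (v s) x * g x\<bar>)"
    proof (rule integral_cong_AE)
      show "AE x in M. \<bar>nl_op (u s) x * g x\<bar> = \<bar>nl_op (v s) x * g x\<bar>"
        using ae by eventually_elim (simp only:)
    qed measurable
    ultimately show "integrable M (\<lambda>x. nl_op (v s) x * g x) \<and>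
        (LINT x|M. nl_op (v s) x * g x) = - form (u s) g / 2 \<and>
        (LINT x|M. \<bar>nl_op (v s) x * g x\<bar>) \<le> 2 * (nsq M (u s) + nsq M g)"
      using integral_nl_op_mult[OF u[OF s] g] integral_abs_nl_op_mult[OF u[OF s] g] by simp
  qed
qed

text \<open>Multiply \<open>mild\<close> by g, integrate over space, exchange the two integrals and
  apply the Green formula. The resulting time integrand is continuous, which makes the pairing
  differentiable although \<open>mild\<close> holds only for almost every x.\<close>

lemma weak_form:
  assumes t: "0 \<le> t" and g: "sq_int M g"
  shows "(LINT x|M. u t x * g x) = (LINT x|M. u0 x * g x) + integral {0..t} (\<lambda>s. - form (u s) g / 2)"
proof -
  interpret LM: pair_sigma_finite lborel M ..
  note [measurable] = sq_int_measurable[OF u[OF t]] sq_int_measurable[OF u0] sq_int_measurable[OF g]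
  define h where "h s x = indicator {0..t} s * (nl_op (v s) x * g x)" for s x
  \<comment> \<open>A bound on the squared norm that is uniform over \<open>{0..t}\<close> dominates
    the space integrals of \<open>h\<close> and so gives integrability on the product.\<close>
  obtain K where K: "0 \<le> K" "\<And>s. s \<in> {0..t} \<Longrightarrow> nsq M (u s) \<le> K"
    using nsq_bounded by blast
  have [measurable]: "case_prod h \<in> borel_measurable (lborel \<Otimes>\<^sub>M M)"
  proof -
    note [measurable] = nl_op_measurable[OF v_measurable, unfolded split_beta']
    show ?thesis unfolding h_def split_beta' by measurable
  qed
  have h_int: "integrable (lborel \<Otimes>\<^sub>M M) (case_prod h)"
  proof (rule LM.Fubini_integrable)
    show "AE s in lborel. integrable M (\<lambda>x. case_prod h (s, x))"
      using integral_nl_op_v[OF g] by eventually_elim (auto simp: h_def indicator_def)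
    show "integrable lborel (\<lambda>s. LINT x|M. norm (case_prod h (s, x)))"
    proof (rule Bochner_Integration.integrable_bound)
      show "integrable lborel (\<lambda>s. indicator {0..t} s * (2 * (K + nsq M g)))"
        by (intro integrable_mult_left integrable_real_indicator) (simp_all add: emeasure_lborel_Icc_eq)
      show "AE s in lborel. norm (LINT x|M. norm (case_prod h (s, x)))
          \<le> norm (indicator {0..t} s * (2 * (K + nsq M g)))"
        using integral_nl_op_v[OF g]
      proof eventually_elim
        case (elim s)
        have "norm (LINT x|M. norm (case_prod h (s, x))) = indicator {0..t} s * (LINT x|M. \<bar>nl_op (v s) x * g x\<bar>)"
          by (simp add: h_def abs_mult)
        also have "\<dots> \<le> indicator {0..t} s * (2 * (K + nsq M g))"
          using elim K by (fastforce simp: indicator_def)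
        finally show ?case using K by simp
      qed
    qed measurable
  qed measurable
  have time: "(LINT s|lborel. h s x) = (LINT s:{0..t}|lborel. nl_op (v s) x) * g x" for x
    by (simp add: h_def set_lebesgue_integral_def flip: mult.assoc)
  have int1: "integrable M (\<lambda>x. LINT s|lborel. h s x)"
    using LM.integrable_snd[OF h_int] by simp
  have "(LINT x|M. u t x * g x) = (LINT x|M. u0 x * g x + (LINT s|lborel. h s x))"
    using mild[OF t] LM.integrable_snd[OF h_int, THEN borel_measurable_integrable]
    by (intro integral_cong_AE) (auto simp: time algebra_simps)
  also have "\<dots> = (LINT x|M. u0 x * g x) + (LINT x|M. LINT s|lborel. h s x)"
    by (intro Bochner_Integration.integral_add int1 sq_int_mult_integrable u0 g)
  also have "(LINT x|M. LINT s|lborel. h s x) = (LINT s|lborel. LINT x|M. h s x)"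
    by (rule LM.Fubini_integral[OF h_int])
  also have "\<dots> = (LINT s:{0..t}|lborel. - form (u s) g / 2)"
    unfolding set_lebesgue_integral_def
  proof (rule integral_cong_AE)
    from half_form_continuous[OF g order_refl]
    show "(\<lambda>s. indicator {0..t} s *\<^sub>R (- form (u s) g / 2)) \<in> borel_measurable lborel"
      unfolding measurable_lborel2 by (intro borel_measurable_continuous_on_indicator) auto
    show "AE s in lborel. (LINT x|M. h s x) = indicator {0..t} s *\<^sub>R (- form (u s) g / 2)"
      using integral_nl_op_v[OF g] by eventually_elim (auto simp: h_def indicator_def)
  qed measurable
  \<comment> \<open>The Henstock-Kurzweil integral is the one whose additivity over intervals and
    fundamental theorem of calculus are used below.\<close>
  also have "\<dots> = integral {0..t} (\<lambda>s. - form (u s) g / 2)"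
  proof (rule set_borel_integral_eq_integral)
    from half_form_continuous[OF g order_refl]
    show "set_integrable lborel {0..t} (\<lambda>s. - form (u s) g / 2)"
      by (rule borel_integrable_atLeastAtMost')
  qed
  finally show ?thesis .
qed

text \<open>Test the weak form between a and b with the increment itself: the left side becomes its
  squared norm, and \<open>form_bound\<close> controls the right side. The norm of the increment is
  thus of order b - a.\<close>

lemma nsq_increment_le:
  assumes ab: "0 \<le> a" "a \<le> b" and K: "\<And>s. s \<in> {a..b} \<Longrightarrow> nsq M (u s) \<le> K"
  shows "nsq M (\<lambda>x. u b x - u a x) \<le> 2 * sqrt (K * nsq M (\<lambda>x. u b x - u a x)) * (b - a)"
proof -
  have b: "0 \<le> b" using ab by simp
  define g where "g = (\<lambda>x. u b x - u a x)"
  have g: "sq_int M g" unfolding g_def by (intro sq_int_diff u ab b)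
  have "nsq M g = (LINT x|M. u b x * g x - u a x * g x)"
    by (simp add: nsq_def g_def power2_eq_square algebra_simps)
  also have "\<dots> = (LINT x|M. u b x * g x) - (LINT x|M. u a x * g x)"
    by (intro Bochner_Integration.integral_diff sq_int_mult_integrable u g ab b)
  also have "\<dots> = integral {0..b} (\<lambda>s. - form (u s) g / 2) - integral {0..a} (\<lambda>s. - form (u s) g / 2)"
    by (simp add: weak_form[OF b g] weak_form[OF ab(1) g])
  also have "\<dots> = integral {a..b} (\<lambda>s. - form (u s) g / 2)"
    using Henstock_Kurzweil_Integration.integral_combine[OF ab
        integrable_continuous_real[OF half_form_continuous[OF g order_refl]]] by simp
  also have "\<dots> \<le> norm (integral {a..b} (\<lambda>s. - form (u s) g / 2))" by simp
  also have "\<dots> \<le> 2 * sqrt (K * nsq M g) * (b - a)"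
  proof (rule integral_bound[OF ab(2) half_form_continuous[OF g ab(1)]])
    fix s assume s: "s \<in> {a..b}"
    have "\<bar>form (u s) g\<bar> \<le> 4 * sqrt (nsq M (u s) * nsq M g)"
      using s ab by (intro form_bound u g) auto
    also have "\<dots> \<le> 4 * sqrt (K * nsq M g)"
      using K[OF s] by (intro mult_left_mono real_sqrt_le_mono mult_right_mono) auto
    finally show "norm (- form (u s) g / 2) \<le> 2 * sqrt (K * nsq M g)" by simp
  qed
  finally show ?thesis unfolding g_def .
qed

text \<open>Dividing the preceding estimate by the time step leaves a multiple of the norm of the
  increment, which tends to 0 by \<open>u_cont\<close>.\<close>

lemma nsq_increment_deriv:
  assumes t: "0 \<le> t"
  shows "((\<lambda>s. nsq M (\<lambda>x. u s x - u t x)) has_real_derivative 0) (at t within {0..})"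
proof -
  \<comment> \<open>The end point t + 1 leaves room for times to the right of t.\<close>
  obtain K where K: "0 \<le> K" "\<And>s. s \<in> {0..t + 1} \<Longrightarrow> nsq M (u s) \<le> K"
    using nsq_bounded by blast
  have bound: "norm (nsq M (\<lambda>x. u s x - u t x) / (s - t)) \<le> 2 * sqrt (K * nsq M (\<lambda>x. u s x - u t x))"
    if s: "0 \<le> s" "s \<noteq> t" "s < t + 1" for s
  proof (cases "s < t")
    case True
    have sym: "nsq M (\<lambda>x. u t x - u s x) = nsq M (\<lambda>x. u s x - u t x)"
      by (simp add: nsq_def power2_commute)
    show ?thesis
      using nsq_increment_le[of s t K] K(2) s t True
      by (simp add: sym abs_divide divide_le_eq mult.commute)
  next
    case False
    then show ?thesis
      using nsq_increment_le[of t s K] K(2) s t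
      by (simp add: abs_divide divide_le_eq mult.commute)
  qed
  have "((\<lambda>s. nsq M (\<lambda>x. u s x - u t x) / (s - t)) \<longlongrightarrow> 0) (at t within {0..})"
  proof (rule Lim_null_comparison)
    show "((\<lambda>s. 2 * sqrt (K * nsq M (\<lambda>x. u s x - u t x))) \<longlongrightarrow> 0) (at t within {0..})"
      by (auto intro!: tendsto_eq_intros u_cont t)
    show "\<forall>\<^sub>F s in at t within {0..}. norm (nsq M (\<lambda>x. u s x - u t x) / (s - t))
        \<le> 2 * sqrt (K * nsq M (\<lambda>x. u s x - u t x))"
      unfolding eventually_at by (rule exI[of _ 1]) (use bound in \<open>auto simp: dist_real_def\<close>)
  qed
  then show ?thesis by (simp add: has_field_derivative_iff nsq_def)
qed

lemma weak_deriv: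
  assumes t: "0 \<le> t" and g: "sq_int M g"
  shows "((\<lambda>s. LINT x|M. u s x * g x) has_real_derivative - form (u t) g / 2) (at t within {0..})"
proof -
  have "((\<lambda>s. (LINT x|M. u0 x * g x) + integral {0..s} (\<lambda>s. - form (u s) g / 2))
      has_real_derivative 0 + - form (u t) g / 2) (at t within {0..t + 1})"
    by (intro DERIV_add DERIV_const integral_has_real_derivative half_form_continuous g) (use t in auto)
  \<comment> \<open>The two sets coincide near t, because t lies strictly below t + 1.\<close>
  also have "at t within {0..t + 1} = at t within {0..}"
    by (rule at_within_nhd[of _ "{..<t + 1}"]) auto
  finally have "((\<lambda>s. (LINT x|M. u0 x * g x) + integral {0..s} (\<lambda>s. - form (u s) g / 2))
      has_real_derivative - form (u t) g / 2) (at t within {0..})"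
    by simp
  then show ?thesis
  proof (rule has_field_derivative_transform_within[OF _ zero_less_one])
    show "(LINT x|M. u0 x * g x) + integral {0..s} (\<lambda>s. - form (u s) g / 2) = (LINT x|M. u s x * g x)"
      if "s \<in> {0..}" for s
      using that by (intro weak_form[symmetric] g) simp
  qed (use t in simp)
qed

text \<open>Expand about the fixed function \<open>g = u t - c\<close>: the linear term is covered
  by \<open>weak_deriv\<close>, whose test function does not move with time, and the quadratic term
  has derivative 0. This replaces a chain rule for L2-valued curves.\<close>

lemma energy_deriv:
  assumes t: "0 \<le> t"
  shows "((\<lambda>s. nsq M (\<lambda>x. u s x - c)) has_real_derivative - form (u t) (u t)) (at t within {0..})"
proof -
  define g where "g = (\<lambda>x. u t x - c)"
  have uc: "sq_int M (\<lambda>x. u s x - c)" if "0 \<le> s" for s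
    by (intro sq_int_diff u sq_int_const that)
  have g: "sq_int M g" unfolding g_def by (rule uc[OF t])
  have expand: "nsq M g + 2 * ((LINT x|M. u s x * g x) - (LINT x|M. u t x * g x)) + nsq M (\<lambda>x. u s x - u t x)
      = nsq M (\<lambda>x. u s x - c)" if s: "0 \<le> s" for s
  proof -
    have "(LINT x|M. (u s x - u t x) * g x) = (LINT x|M. u s x * g x) - (LINT x|M. u t x * g x)"
      using sq_int_mult_integrable[OF u g] s t by (simp add: left_diff_distrib)
    then show ?thesis
      using nsq_diff_expand[OF uc[OF s] g] by (simp add: g_def)
  qed
  have "((\<lambda>s. nsq M g + 2 * ((LINT x|M. u s x * g x) - (LINT x|M. u t x * g x)) + nsq M (\<lambda>x. u s x - u t x))
      has_real_derivative 0 + 2 * (- form (u t) g / 2 - 0) + 0) (at t within {0..})"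
    by (intro DERIV_add DERIV_const DERIV_cmult DERIV_diff weak_deriv nsq_increment_deriv t g)
  then have "((\<lambda>s. nsq M (\<lambda>x. u s x - c)) has_real_derivative 0 + 2 * (- form (u t) g / 2 - 0) + 0)
      (at t within {0..})"
  proof (rule has_field_derivative_transform_within[OF _ zero_less_one])
    show "nsq M g + 2 * ((LINT x|M. u s x * g x) - (LINT x|M. u t x * g x)) + nsq M (\<lambda>x. u s x - u t x)
      = nsq M (\<lambda>x. u s x - c)" if "s \<in> {0..}" for s
      using that by (intro expand) simp
  qed (use t in simp)
  moreover have "form (u t) g = form (u t) (u t)"
    unfolding g_def by (rule form_shift)
  ultimately show ?thesis by simp
qed

text \<open>The test function 1 has no differences, so the form in the weak equation
  vanishes.\<close>

lemma integral_conserved: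
  assumes "0 \<le> t"
  shows "(LINT x|M. u t x) = (LINT x|M. u0 x)"
  using weak_form[OF assms sq_int_const[of 1]] by (simp add: form_def split_beta')

text \<open>A Gronwall argument with integrating factor \<open>exp (b * s)\<close>: by
  \<open>energy_deriv\<close> and the gap, its product with the squared distance to c has
  nonpositive derivative.\<close>

lemma exponential_decay:
  assumes gap: "\<And>f. sq_int M f \<Longrightarrow>
      b * nsq M (\<lambda>x. f x - (LINT x|M. f x) / measure M (space M)) \<le> form f f"
    and t: "0 \<le> t" and c: "c = (LINT x|M. u0 x) / measure M (space M)"
  shows "nsq M (\<lambda>x. u t x - c) \<le> exp (- b * t) * nsq M (\<lambda>x. u0 x - c)"
proof -
  \<comment> \<open>The mean of \<open>u s\<close> is c at every time, so the gap applies with this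
    one constant.\<close>
  have gap_u: "b * nsq M (\<lambda>x. u s x - c) \<le> form (u s) (u s)" if "0 \<le> s" for s
    using gap[OF u[OF that]] by (simp add: c integral_conserved[OF that])
  have deriv: "((\<lambda>s. exp (b * s) * nsq M (\<lambda>x. u s x - c)) has_real_derivative
      exp (b * s) * (b * nsq M (\<lambda>x. u s x - c) - form (u s) (u s))) (at s within {0..})" if "0 \<le> s" for s
    by (rule derivative_eq_intros energy_deriv[OF that] refl | simp add: algebra_simps)+
  have "exp (b * t) * nsq M (\<lambda>x. u t x - c) \<le> exp (b * 0) * nsq M (\<lambda>x. u 0 x - c)"
  proof (rule DERIV_nonpos_imp_decreasing_open[OF t])
    fix s :: real assume s: "0 < s" "s < t"
    have "at s within {0..} = at s"
      using s by (intro at_within_interior) simp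
    then show "\<exists>y. ((\<lambda>s. exp (b * s) * nsq M (\<lambda>x. u s x - c)) has_real_derivative y) (at s) \<and> y \<le> 0"
      using deriv[of s] gap_u[of s] s by (auto intro!: mult_nonneg_nonpos)
  next
    show "continuous_on {0..t} (\<lambda>s. exp (b * s) * nsq M (\<lambda>x. u s x - c))"
    proof (rule continuous_on_subset)
      show "continuous_on {0..} (\<lambda>s. exp (b * s) * nsq M (\<lambda>x. u s x - c))"
        using deriv by (intro DERIV_continuous_on) auto
    qed auto
  qed
  \<comment> \<open>At time 0 the mild equation integrates over a single point, so
    \<open>u 0\<close> equals \<open>u0\<close> almost everywhere.\<close>
  moreover have "nsq M (\<lambda>x. u 0 x - c) = nsq M (\<lambda>x. u0 x - c)"
  proof -
    have "AE s in lborel. indicator {0..0::real} s *\<^sub>R nl_op (v s) x = 0" for x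
      using AE_lborel_singleton[of 0] by eventually_elim (auto simp: indicator_def)
    then have "(LINT s:{0..0}|lborel. nl_op (v s) x) = 0" for x
      unfolding set_lebesgue_integral_def by (rule integral_eq_zero_AE)
    then show ?thesis
      unfolding nsq_def using mild[of 0] sq_int_measurable[OF u0] sq_int_measurable[OF u[of 0]]
      by (intro integral_cong_AE) auto
  qed
  ultimately show ?thesis
    by (simp add: exp_minus field_simps)
qed

end

subsection \<open>The nonlocal Poincare inequality\<close>

text \<open>The reference value is a parameter, so that one constant can be kept while the set moves
  along a chain of balls. The integral is not divided by the measure of A.\<close>

definition dev_on :: "'a measure \<Rightarrow> 'a set \<Rightarrow> ('a \<Rightarrow> real) \<Rightarrow> real \<Rightarrow> real" where
  "dev_on M A f c = (LINT x|M. indicator A x * (f x - c)\<^sup>2)"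

lemma dev_on_space: "dev_on M (space M) f c = nsq M (\<lambda>x. f x - c)"
  unfolding dev_on_def nsq_def by (rule Bochner_Integration.integral_cong) auto

context finite_measure
begin

lemma integrable_indicator_sets [simp]: "A \<in> sets M \<Longrightarrow> integrable M (indicator A :: 'a \<Rightarrow> real)"
  by (intro integrable_real_indicator) (simp_all add: emeasure_eq_measure)

lemma dev_on_integrable:
  assumes f: "sq_int M f" and A: "A \<in> sets M"
  shows "integrable M (\<lambda>x. indicator A x * (f x - c)\<^sup>2)"
  by (rule integrable_real_mult_indicator[OF A, unfolded mult.commute[of _ "indicator A _"]])
    (rule sq_int_integrable[OF sq_int_diff[OF f sq_int_const]])

text \<open>As a function of c the deviation is a quadratic with leading coefficient
  \<open>measure M A\<close>; completing the square puts its minimum at the mean.\<close>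

lemma dev_on_mean_le:
  assumes f: "sq_int M f" and A: "A \<in> sets M" and pos: "0 < measure M A"
  shows "dev_on M A f ((LINT x|M. indicator A x * f x) / measure M A) \<le> dev_on M A f c"
proof -
  define a p q where "a = measure M A" and "p = (LINT x|M. indicator A x * f x)"
    and "q = (LINT x|M. indicator A x * (f x)\<^sup>2)"
  have ints: "integrable M (\<lambda>x. indicator A x * f x)" "integrable M (\<lambda>x. indicator A x * (f x)\<^sup>2)"
    "integrable M (indicator A :: 'a \<Rightarrow> real)"
    using integrable_real_mult_indicator[OF A sq_int_imp_integrable[OF f]]
      integrable_real_mult_indicator[OF A sq_int_integrable[OF f]] A
    by (simp_all add: mult.commute)
  have expand: "dev_on M A f c = q - 2 * c * p + c\<^sup>2 * a" for c
  proof -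
    have "dev_on M A f c = (LINT x|M. indicator A x * (f x)\<^sup>2 - 2 * c * (indicator A x * f x) + c\<^sup>2 * indicator A x)"
      unfolding dev_on_def
      by (rule Bochner_Integration.integral_cong) (auto simp: power2_eq_square algebra_simps)
    also have "\<dots> = q - 2 * c * p + c\<^sup>2 * a"
      using ints A by (simp add: a_def p_def q_def)
    finally show ?thesis .
  qed
  have "dev_on M A f c - dev_on M A f (p / a) = (p - c * a)\<^sup>2 / a"
    using pos unfolding expand a_def[symmetric] by (simp add: field_simps power2_eq_square)
  moreover have "0 \<le> (p - c * a)\<^sup>2 / a" using pos by (simp add: a_def)
  ultimately show ?thesis unfolding p_def a_def by linarith
qed

end

section \<open>Oscillation on sets where the kernel is bounded below\<close>

context nonlocal_kernel
begin

definition energy :: "('a \<Rightarrow> real) \<Rightarrow> 'a \<Rightarrow> real" where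
  "energy f x = (LINT y|M. k x y * (f y - f x)\<^sup>2)"

lemma
  assumes f: "sq_int M f"
  shows energy_integrable: "integrable M (energy f)"
    and integral_energy: "(LINT x|M. energy f x) = form f f"
    and AE_energy: "AE x in M. integrable M (\<lambda>y. k x y * (f y - f x)\<^sup>2)"
  using MM.integrable_fst'[OF form_integrable[OF f f]] form_iterated[OF f f]
    MM.AE_integrable_fst'[OF form_integrable[OF f f]]
  by (simp_all add: energy_def[abs_def] power2_eq_square)

lemma energy_nonneg: "0 \<le> energy f x"
  unfolding energy_def by (intro integral_nonneg_AE AE_I2) (auto simp: k_nonneg)

text \<open>For x in A, restricting the integral in \<open>energy\<close> to y in B and replacing k
  by its lower bound leaves c times the deviation from f x. The comparison holds almost everywhere
  because the inner integral has to exist.\<close>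

lemma AE_dev_on_le_energy:
  assumes f: "sq_int M f" and B: "B \<in> sets M"
    and k: "\<And>x y. x \<in> A \<Longrightarrow> y \<in> B \<Longrightarrow> c \<le> k x y"
  shows "AE x in M. x \<in> A \<longrightarrow> c * dev_on M B f (f x) \<le> energy f x"
  using AE_energy[OF f]
proof eventually_elim
  case (elim x)
  show ?case
  proof
    assume x: "x \<in> A"
    have "c * dev_on M B f (f x) = (LINT y|M. c * (indicator B y * (f y - f x)\<^sup>2))"
      by (simp add: dev_on_def)
    also have "\<dots> \<le> energy f x"
      unfolding energy_def
    proof (rule integral_mono[OF _ elim])
      show "integrable M (\<lambda>y. c * (indicator B y * (f y - f x)\<^sup>2))"
        by (intro integrable_mult_right dev_on_integrable f B)
      show "c * (indicator B y * (f y - f x)\<^sup>2) \<le> k x y * (f y - f x)\<^sup>2" for y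
        using k[OF x, of y] k_nonneg[of x y] by (auto simp: indicator_def mult_right_mono)
    qed
    finally show "c * dev_on M B f (f x) \<le> energy f x" .
  qed
qed

text \<open>A local Poincare inequality: the deviation from the mean is at most that from f x, which
  the energy density controls; integrating over x in A gives the form.\<close>

lemma dev_on_mean_le_form:
  assumes f: "sq_int M f" and A: "A \<in> sets M" and pos: "0 < measure M A"
    and c: "0 < c" and k: "\<And>x y. x \<in> A \<Longrightarrow> y \<in> A \<Longrightarrow> c \<le> k x y"
  shows "measure M A * dev_on M A f ((LINT x|M. indicator A x * f x) / measure M A) \<le> form f f / c"
    (is "_ * ?V \<le> _")
proof -
  have "measure M A * ?V = (LINT x|M. indicator A x * ?V)"
    using A by simp
  also have "\<dots> \<le> (LINT x|M. energy f x / c)"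
  proof (rule integral_mono_AE)
    show "integrable M (\<lambda>x. indicator A x * ?V)"
      using A by (intro integrable_mult_left) simp
    show "integrable M (\<lambda>x. energy f x / c)"
      by (intro integrable_divide energy_integrable f)
    have "AE x in M. x \<in> A \<longrightarrow> c * dev_on M A f (f x) \<le> energy f x"
      by (rule AE_dev_on_le_energy[OF f A]) (rule k)
    then show "AE x in M. indicator A x * ?V \<le> energy f x / c"
    proof eventually_elim
      case (elim x)
      show ?case
      proof (cases "x \<in> A")
        case True
        have "c * ?V \<le> c * dev_on M A f (f x)"
          using c by (intro mult_left_mono dev_on_mean_le f A pos) simp
        also have "\<dots> \<le> energy f x" using elim True by simp
        finally have "?V \<le> energy f x / c"
          by (simp only: pos_le_divide_eq[OF c] mult.commute[of c])
        then show ?thesis using True by simp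
      qed (use energy_nonneg c in simp)
    qed
  qed
  also have "\<dots> = form f f / c"
    by (simp add: integral_energy[OF f])
  finally show ?thesis .
qed

text \<open>Split f y - m into f y - f x and f x - m, then integrate over y in B and x in A: an
  estimate around m passes from A to B at the price of a multiple of the form.\<close>

lemma dev_on_spread:
  assumes f: "sq_int M f" and A: "A \<in> sets M" and B: "B \<in> sets M"
    and c: "0 < c" and k: "\<And>x y. x \<in> A \<Longrightarrow> y \<in> B \<Longrightarrow> c \<le> k x y"
  shows "measure M A * dev_on M B f m \<le> 2 / c * form f f + 2 * measure M B * dev_on M A f m"
proof -
  have "measure M A * dev_on M B f m = (LINT x|M. indicator A x * dev_on M B f m)"
    using A by simp
  also have "\<dots> \<le> (LINT x|M. 2 / c * energy f x + 2 * measure M B * (indicator A x * (f x - m)\<^sup>2))"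
  proof (rule integral_mono_AE)
    show "integrable M (\<lambda>x. indicator A x * dev_on M B f m)"
      using A by (intro integrable_mult_left) simp
    show "integrable M (\<lambda>x. 2 / c * energy f x + 2 * measure M B * (indicator A x * (f x - m)\<^sup>2))"
      by (intro Bochner_Integration.integrable_add integrable_mult_right energy_integrable
          dev_on_integrable f A)
    have "AE x in M. x \<in> A \<longrightarrow> c * dev_on M B f (f x) \<le> energy f x"
      by (rule AE_dev_on_le_energy[OF f B]) (rule k)
    then show "AE x in M. indicator A x * dev_on M B f m
        \<le> 2 / c * energy f x + 2 * measure M B * (indicator A x * (f x - m)\<^sup>2)"
    proof eventually_elim
      case (elim x)
      show ?case
      proof (cases "x \<in> A")
        case True
        have "dev_on M B f m \<le> (LINT y|M. 2 * (indicator B y * (f y - f x)\<^sup>2) + 2 * (f x - m)\<^sup>2 * indicator B y)"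
          unfolding dev_on_def
        proof (rule integral_mono)
          show "integrable M (\<lambda>y. indicator B y * (f y - m)\<^sup>2)"
            by (rule dev_on_integrable[OF f B])
          show "integrable M (\<lambda>y. 2 * (indicator B y * (f y - f x)\<^sup>2) + 2 * (f x - m)\<^sup>2 * indicator B y)"
            using B by (intro Bochner_Integration.integrable_add integrable_mult_right dev_on_integrable f) simp_all
          show "indicator B y * (f y - m)\<^sup>2
              \<le> 2 * (indicator B y * (f y - f x)\<^sup>2) + 2 * (f x - m)\<^sup>2 * indicator B y" for y
            using sq_diff_le[of "f y - f x" "m - f x"] by (auto simp: indicator_def power2_commute)
        qed
        also have "\<dots> = 2 * dev_on M B f (f x) + 2 * (f x - m)\<^sup>2 * measure M B"
          using B by (subst Bochner_Integration.integral_add)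
            (auto intro!: integrable_mult_right dev_on_integrable f simp: dev_on_def)
        also have "\<dots> \<le> 2 * (energy f x / c) + 2 * (f x - m)\<^sup>2 * measure M B"
          using elim True c by (simp add: le_divide_eq mult.commute)
        finally show ?thesis using True by (simp add: algebra_simps)
      qed (use energy_nonneg c in simp)
    qed
  qed
  also have "\<dots> = 2 / c * form f f + 2 * measure M B * dev_on M A f m"
    using f A energy_integrable[OF f] dev_on_integrable[OF f A]
    by (subst Bochner_Integration.integral_add) (auto simp: integral_energy dev_on_def)
  finally show ?thesis .
qed

end

text \<open>Points of two balls of radius r whose centres are less than r apart have distance below
  3 * r, where k is bounded below. The positive measure of the balls permits the division at each
  step of a chain.\<close>

lemma nonlocal_Poincare:
  fixes M :: "'a::euclidean_space measure"
  assumes "nonlocal_kernel M k"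
    and bounded: "bounded (space M)" and connected: "connected (space M)" and ne: "space M \<noteq> {}"
    and r: "0 < r" and c: "0 < c"
    and k: "\<And>x y. x \<in> space M \<Longrightarrow> y \<in> space M \<Longrightarrow> dist x y < 3 * r \<Longrightarrow> c \<le> k x y"
    and balls: "\<And>x. x \<in> space M \<Longrightarrow> ball x r \<inter> space M \<in> sets M \<and> 0 < measure M (ball x r \<inter> space M)"
  obtains C where "0 < C"
    "\<And>f. sq_int M f \<Longrightarrow> nsq M (\<lambda>x. f x - (LINT x|M. f x) / measure M (space M)) \<le> C * nonlocal_kernel.form M k f f"
proof -
  interpret nonlocal_kernel M k by fact
  define A where "A x = ball x r \<inter> space M" for x
  have A: "A x \<in> sets M" "0 < measure M (A x)" if "x \<in> space M" for x
    using balls[OF that] by (auto simp: A_def)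
  obtain x0 where x0: "x0 \<in> space M" using ne by auto
  define m where "m f = (LINT x|M. indicator (A x0) x * f x) / measure M (A x0)" for f :: "'a \<Rightarrow> real"
  \<comment> \<open>The constant may depend on x but not on f, and the reference value
    \<open>m f\<close> is the mean over the first ball throughout.\<close>
  define P where "P x \<longleftrightarrow> (\<exists>C\<ge>0. \<forall>f. sq_int M f \<longrightarrow> dev_on M (A x) f (m f) \<le> C * form f f)" for x
  have base: "P x0"
    unfolding P_def
  proof (intro exI conjI allI impI)
    show "0 \<le> 1 / (c * measure M (A x0))" using c by simp
    fix f assume f: "sq_int M f"
    have "measure M (A x0) * dev_on M (A x0) f (m f) \<le> form f f / c"
      unfolding m_def
    proof (rule dev_on_mean_le_form[OF f A[OF x0] c])
      fix x y assume "x \<in> A x0" "y \<in> A x0"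
      then show "c \<le> k x y"
        using dist_triangle2[of x y x0] r by (intro k) (auto simp: A_def dist_commute)
    qed
    then show "dev_on M (A x0) f (m f) \<le> 1 / (c * measure M (A x0)) * form f f"
      using A[OF x0] c by (simp add: field_simps)
  qed
  have step: "P y" if x: "x \<in> space M" and y: "y \<in> space M" and xy: "dist x y < r" and "P x" for x y
  proof -
    obtain C where C: "0 \<le> C" "\<And>f. sq_int M f \<Longrightarrow> dev_on M (A x) f (m f) \<le> C * form f f"
      using \<open>P x\<close> unfolding P_def by blast
    \<comment> \<open>This is \<open>dev_on_spread\<close> with the bound at x inserted, divided by
      the measure of the ball at x.\<close>
    define D where "D = (2 / c + 2 * measure M (A y) * C) / measure M (A x)"
    have "dev_on M (A y) f (m f) \<le> D * form f f" if f: "sq_int M f" for f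
    proof -
      have "measure M (A x) * dev_on M (A y) f (m f)
          \<le> 2 / c * form f f + 2 * measure M (A y) * dev_on M (A x) f (m f)"
      proof (rule dev_on_spread[OF f A(1)[OF x] A(1)[OF y] c])
        fix x' y' assume "x' \<in> A x" "y' \<in> A y"
        moreover have "dist x' y' \<le> dist x' x + dist x y + dist y y'"
          using dist_triangle[of x' y' x] dist_triangle[of x y' y] by simp
        ultimately show "c \<le> k x' y'"
          using xy by (intro k) (auto simp: A_def dist_commute)
      qed
      also have "\<dots> \<le> 2 / c * form f f + 2 * measure M (A y) * (C * form f f)"
        by (intro add_left_mono mult_left_mono C f) simp
      finally show ?thesis
        using A(2)[OF x] unfolding D_def by (simp add: field_simps)
    qed
    moreover have "0 \<le> D" using c C(1) by (simp add: D_def)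
    ultimately show ?thesis unfolding P_def by blast
  qed
  \<comment> \<open>\<open>P\<close> is locally constant, since any two points of a ball of radius r
    / 2 are less than r apart and \<open>step\<close> links them; connectedness carries it from
    \<open>x0\<close> to every point.\<close>
  have P: "P x" if x: "x \<in> space M" for x
  proof (rule connected_induction_simple[where P = P, OF connected x0 x base])
    fix a assume a: "a \<in> space M"
    show "\<exists>T. openin (top_of_set (space M)) T \<and> a \<in> T \<and> (\<forall>x\<in>T. \<forall>y\<in>T. P x \<longrightarrow> P y)"
    proof (intro exI conjI ballI impI)
      show "openin (top_of_set (space M)) (space M \<inter> ball a (r / 2))" by auto
      show "a \<in> space M \<inter> ball a (r / 2)" using a r by simp
      fix x y assume "x \<in> space M \<inter> ball a (r / 2)" "y \<in> space M \<inter> ball a (r / 2)" "P x"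
      then show "P y"
        using dist_triangle2[of x y a] by (intro step[of x y]) (auto simp: dist_commute)
    qed
  qed
  \<comment> \<open>Every point of the closure is within r of a point of the space, so balls centred
    in the space cover the compact closure and finitely many of them suffice.\<close>
  have "closure (space M) \<subseteq> (\<Union>x\<in>space M. ball x r)"
    using closure_approachable[of _ "space M"] r by (auto simp: dist_commute)
  then obtain K where K: "K \<subseteq> space M" "finite K" "closure (space M) \<subseteq> (\<Union>x\<in>K. ball x r)"
    using compactE_image[of "closure (space M)" "space M" "\<lambda>x. ball x r"] bounded by auto
  have cover: "space M \<subseteq> (\<Union>x\<in>K. A x)"
    using K(3) closure_subset[of "space M"] by (fastforce simp: A_def)
  have "\<forall>x\<in>K. \<exists>C\<ge>0. \<forall>f. sq_int M f \<longrightarrow> dev_on M (A x) f (m f) \<le> C * form f f"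
    using P K(1) unfolding P_def by blast
  then obtain C where C: "\<And>x. x \<in> K \<Longrightarrow> 0 \<le> C x"
    "\<And>x f. x \<in> K \<Longrightarrow> sq_int M f \<Longrightarrow> dev_on M (A x) f (m f) \<le> C x * form f f"
    by metis
  have KA: "A x \<in> sets M" if "x \<in> K" for x using A K(1) that by auto
  \<comment> \<open>The added 1 keeps the constant strictly positive even if the sum is 0.\<close>
  have "nsq M (\<lambda>x. f x - (LINT x|M. f x) / measure M (space M)) \<le> (sum C K + 1) * form f f"
    if f: "sq_int M f" for f
  proof -
    have "0 < measure M (space M)"
      using A[OF x0] bounded_measure[of "A x0"] by simp
    \<comment> \<open>The global mean minimises the deviation over the whole space, so it can be
      traded for \<open>m f\<close>.\<close>
    then have "nsq M (\<lambda>x. f x - (LINT x|M. f x) / measure M (space M)) \<le> dev_on M (space M) f (m f)"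
      using dev_on_mean_le[OF f sets.top, of "m f"]
      by (simp add: dev_on_space cong: Bochner_Integration.integral_cong)
    also have "\<dots> \<le> (LINT x|M. (\<Sum>y\<in>K. indicator (A y) x * (f x - m f)\<^sup>2))"
      unfolding dev_on_def
    proof (rule integral_mono)
      show "integrable M (\<lambda>x. indicator (space M) x * (f x - m f)\<^sup>2)"
        by (rule dev_on_integrable[OF f sets.top])
      show "integrable M (\<lambda>x. \<Sum>y\<in>K. indicator (A y) x * (f x - m f)\<^sup>2)"
        by (intro Bochner_Integration.integrable_sum dev_on_integrable f KA)
      fix x assume x: "x \<in> space M"
      then obtain y where y: "y \<in> K" "x \<in> A y" using cover by auto
      then have "indicator (A y) x * (f x - m f)\<^sup>2 \<le> (\<Sum>y\<in>K. indicator (A y) x * (f x - m f)\<^sup>2)"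
        by (intro member_le_sum) (auto simp: K)
      then show "indicator (space M) x * (f x - m f)\<^sup>2 \<le> (\<Sum>y\<in>K. indicator (A y) x * (f x - m f)\<^sup>2)"
        using x y by simp
    qed
    also have "\<dots> = (\<Sum>y\<in>K. dev_on M (A y) f (m f))"
      unfolding dev_on_def by (intro Bochner_Integration.integral_sum dev_on_integrable f KA)
    also have "\<dots> \<le> (\<Sum>y\<in>K. C y * form f f)"
      by (intro sum_mono C f)
    also have "\<dots> \<le> (sum C K + 1) * form f f"
      using form_nonneg[of f] by (simp add: sum_distrib_right distrib_right)
    finally show ?thesis .
  qed
  moreover have "0 < sum C K + 1"
    using sum_nonneg[of K C] C(1) by fastforce
  ultimately show ?thesis by (rule that[rotated])
qed

subsection \<open>The kernel and the solution on the domain\<close>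

lemma lborel_distr_reflect: "lborel = distr lborel borel (\<lambda>x. t - x :: 'a::euclidean_space)"
proof -
  have "lborel = density (distr lborel borel (\<lambda>x. t + (-1) *\<^sub>R x)) (\<lambda>_. ennreal (\<bar>-1\<bar> ^ DIM('a)))"
    by (rule lborel_affine) simp
  also have "\<dots> = distr lborel borel (\<lambda>x. t - x)"
    by (simp add: density_1)
  finally show ?thesis .
qed

lemma AE_lborel_reflect:
  fixes t :: "'a::euclidean_space"
  assumes "AE x in lborel. P x"
  shows "AE x in lborel. P (t - x)"
proof (rule AE_distrD[where M' = borel and f = "\<lambda>x. t - x" and P = P])
  show "AE x in distr lborel borel (\<lambda>x. t - x). P x"
    by (subst lborel_distr_reflect[symmetric]) (rule assms)
qed simp

lemma nn_integral_lborel_reflect: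
  fixes f :: "'a::euclidean_space \<Rightarrow> ennreal"
  assumes [measurable]: "f \<in> borel_measurable borel"
  shows "(\<integral>\<^sup>+x. f (t - x) \<partial>lborel) = (\<integral>\<^sup>+x. f x \<partial>lborel)"
proof -
  have "(\<integral>\<^sup>+x. f x \<partial>lborel) = (\<integral>\<^sup>+x. f x \<partial>distr lborel borel (\<lambda>x. t - x))"
    by (subst lborel_distr_reflect[symmetric]) (rule refl)
  also have "\<dots> = (\<integral>\<^sup>+x. f (t - x) \<partial>lborel)"
    by (rule nn_integral_distr) simp_all
  finally show ?thesis by (rule sym)
qed

lemma lebesgue_measurable_reflect:
  fixes f :: "'a::euclidean_space \<Rightarrow> real"
  assumes "f \<in> borel_measurable lebesgue"
  shows "(\<lambda>y. f (t - y)) \<in> borel_measurable lebesgue"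
proof -
  have eq: "(\<lambda>y. t + (\<Sum>j\<in>Basis. (- 1 * (y \<bullet> j)) *\<^sub>R j)) = (\<lambda>y. t - y)"
    by (simp add: sum_negf euclidean_representation)
  have "(\<lambda>y. t - y) \<in> lebesgue \<rightarrow>\<^sub>M lebesgue"
    using lebesgue_affine_measurable[of "\<lambda>_. - 1" t] unfolding eq by simp
  from measurable_compose[OF this assms] show ?thesis .
qed

lemma smooth_bounded_domainD:
  assumes "smooth_bounded_domain \<Omega>"
  shows "open \<Omega>" "bounded \<Omega>" "connected \<Omega>" "\<Omega> \<noteq> {}"
proof -
  obtain \<phi> where \<phi>: "smooth_fun \<phi>" "\<Omega> = {x. \<phi> x < 0}"
    using assms by (auto simp: smooth_bounded_domain_def)
  have "\<forall>x. \<phi> differentiable (at x)"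
    using \<phi>(1) by (cases rule: smooth_fun.cases) auto
  then have "continuous_on UNIV \<phi>"
    by (intro continuous_at_imp_continuous_on ballI differentiable_imp_continuous_within) auto
  then show "open \<Omega>"
    unfolding \<phi>(2) by (intro open_Collect_less) auto
qed (use assms in \<open>auto simp: smooth_bounded_domain_def\<close>)

text \<open>A Borel kernel makes \<open>J' (x - y)\<close> measurable on the product. An arbitrary
  Borel version of J inherits evenness, sign and lower bound only almost everywhere, so it is
  corrected to have them at every point.\<close>

lemma kernel_J_Borel_version:
  fixes J :: "'a::euclidean_space \<Rightarrow> real"
  assumes J: "kernel_J J d"
  obtains c J' where "0 < d" "0 < c" "J' \<in> borel_measurable borel" "AE x in lborel. J x = J' x"
    "\<And>x. 0 \<le> J' x" "\<And>x. J' (- x) = J' x" "(\<integral>\<^sup>+x. ennreal (J' x) \<partial>lborel) = 1" "\<And>x. norm x < d / 2 \<Longrightarrow> c \<le> J' x"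
proof -
  have J_meas: "J \<in> borel_measurable lebesgue" and J_nonneg: "\<And>x. 0 \<le> J x" and J_sym: "\<And>x. J (- x) = J x"
    and J_int: "integrable lebesgue J" "integral\<^sup>L lebesgue J = 1"
    and J_out: "\<And>x. x \<notin> ball 0 d \<Longrightarrow> J x = 0"
    and J_low: "\<And>\<rho>. \<rho> < d \<Longrightarrow> \<exists>c>0. \<forall>x\<in>ball 0 \<rho>. c \<le> J x"
    using J by (auto simp: kernel_J_def)
  \<comment> \<open>Otherwise the ball is empty and J vanishes identically, against its integral
    being 1.\<close>
  have d: "0 < d"
  proof (rule ccontr)
    assume "\<not> 0 < d"
    then have "J x = 0" for x using J_out[of x] by (smt (verit) mem_ball norm_ge_zero dist_0_norm)
    then have "J = (\<lambda>_. 0)" by auto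
    then show False using J_int(2) by simp
  qed
  obtain c where c: "0 < c" "\<And>x. x \<in> ball 0 (d / 2) \<Longrightarrow> c \<le> J x"
    using J_low[of "d / 2"] d by auto
  obtain J0 where J0 [measurable]: "J0 \<in> borel_measurable lborel" and JJ0: "AE x in lborel. J x = J0 x"
    using completion_ex_borel_measurable_real[OF J_meas] by auto
  \<comment> \<open>The average makes the function even; the maximum makes it nonnegative and at
    least c on the ball of radius d / 2. Since J has these properties itself, the result still
    agrees with J almost everywhere.\<close>
  define J' where "J' x = max (c * indicator (ball 0 (d / 2)) x) ((J0 x + J0 (- x)) / 2)" for x
  have [measurable]: "J0 \<in> borel_measurable borel" "ball (0 :: 'a) (d / 2) \<in> sets borel"
    using J0 by simp_all
  have meas [measurable]: "J' \<in> borel_measurable borel"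
    unfolding J'_def by measurable
  have ae: "AE x in lborel. J x = J' x"
    using JJ0 AE_lborel_reflect[OF JJ0, of 0]
  proof eventually_elim
    case (elim x)
    then have "(J0 x + J0 (- x)) / 2 = J x" using J_sym[of x] by simp
    moreover have "c * indicator (ball 0 (d / 2)) x \<le> J x"
      using c(2)[of x] J_nonneg[of x] by (simp add: indicator_def)
    ultimately show "J x = J' x" by (simp add: J'_def)
  qed
  have "(\<integral>\<^sup>+x. ennreal (J' x) \<partial>lborel) = (\<integral>\<^sup>+x. ennreal (J' x) \<partial>lebesgue)"
    by (rule nn_integral_completion[symmetric]) 
  also have "\<dots> = (\<integral>\<^sup>+x. ennreal (J x) \<partial>lebesgue)"
    by (rule nn_integral_cong_AE) (use AE_completion[OF ae] in \<open>auto elim: eventually_mono\<close>)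
  also have "\<dots> = 1"
    using nn_integral_eq_integral[OF J_int(1)] J_nonneg J_int(2) by simp
  finally have mass: "(\<integral>\<^sup>+x. ennreal (J' x) \<partial>lborel) = 1" .
  have "0 \<le> c * indicator (ball 0 (d / 2)) x" for x :: 'a using c(1) by simp
  then have "0 \<le> J' x" for x unfolding J'_def by (simp add: le_max_iff_disj)
  moreover have "J' (- x) = J' x" for x by (simp add: J'_def indicator_def add.commute)
  moreover have "c \<le> J' x" if "norm x < d / 2" for x using that by (simp add: J'_def)
  ultimately show thesis using that d c(1) meas ae mass by blast
qed

lemma convolution_kernel:
  fixes J' :: "'a::euclidean_space \<Rightarrow> real"
  assumes \<Omega>: "\<Omega> \<in> lmeasurable" and J' [measurable]: "J' \<in> borel_measurable borel"
    and nonneg: "\<And>x. 0 \<le> J' x" and sym: "\<And>x. J' (- x) = J' x"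
    and mass: "(\<integral>\<^sup>+x. ennreal (J' x) \<partial>lborel) = 1"
  shows "nonlocal_kernel (lebesgue_on \<Omega>) (\<lambda>x y. J' (x - y))"
proof -
  interpret finite_measure "lebesgue_on \<Omega>" by (rule finite_measure_lebesgue_on[OF \<Omega>])
  have id [measurable]: "(\<lambda>x. x) \<in> lebesgue_on \<Omega> \<rightarrow>\<^sub>M borel"
    using id_borel_measurable_lebesgue_on[of \<Omega>] by (simp add: id_def)
  show ?thesis
  proof
    have [measurable]: "fst \<in> lebesgue_on \<Omega> \<Otimes>\<^sub>M lebesgue_on \<Omega> \<rightarrow>\<^sub>M borel" "snd \<in> lebesgue_on \<Omega> \<Otimes>\<^sub>M lebesgue_on \<Omega> \<rightarrow>\<^sub>M borel"
      using measurable_compose[OF measurable_fst id] measurable_compose[OF measurable_snd id] by simp_all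
    show "(\<lambda>(x, y). J' (x - y)) \<in> borel_measurable (lebesgue_on \<Omega> \<Otimes>\<^sub>M lebesgue_on \<Omega>)"
      unfolding split_beta' by measurable
    show "J' (x - y) = J' (y - x)" for x y
      using sym[of "x - y"] by simp
    show "(\<integral>\<^sup>+y. ennreal (J' (x - y)) \<partial>lebesgue_on \<Omega>) \<le> 1" for x
    proof -
      have "(\<integral>\<^sup>+y. ennreal (J' (x - y)) \<partial>lebesgue_on \<Omega>) = (\<integral>\<^sup>+y. ennreal (J' (x - y)) * indicator \<Omega> y \<partial>lebesgue)"
        using \<Omega> by (intro nn_integral_restrict_space) auto
      also have "\<dots> \<le> (\<integral>\<^sup>+y. ennreal (J' (x - y)) \<partial>lebesgue)"
        by (intro nn_integral_mono) (auto simp: indicator_def)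
      also have "\<dots> = (\<integral>\<^sup>+y. ennreal (J' (x - y)) \<partial>lborel)"
        by (rule nn_integral_completion)
      also have "\<dots> = 1"
        using nn_integral_lborel_reflect[of "\<lambda>z. ennreal (J' z)" x] mass by simp
      finally show ?thesis .
    qed
  qed (rule nonneg)
qed

text \<open>For each fixed x, reflection maps the null set where J and J' differ to a null set, so
  the exchange of kernels is valid at every x and not only at almost every one.\<close>

lemma integral_AE_eq_kernel:
  fixes J :: "'a::euclidean_space \<Rightarrow> real"
  assumes \<Omega>: "\<Omega> \<in> lmeasurable" and J: "J \<in> borel_measurable lebesgue" and J': "J' \<in> borel_measurable borel"
    and ae: "AE x in lborel. J x = J' x" and [measurable]: "h \<in> borel_measurable (lebesgue_on \<Omega>)"
  shows "(LINT y|lebesgue_on \<Omega>. J (x - y) * h y) = (LINT y|lebesgue_on \<Omega>. J' (x - y) * h y)"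
proof (rule integral_cong_AE)
  have [measurable]: "(\<lambda>y. J (x - y)) \<in> borel_measurable (lebesgue_on \<Omega>)"
    by (intro measurable_restrict_space1 lebesgue_measurable_reflect J)
  have [measurable]: "(\<lambda>y. J' (x - y)) \<in> borel_measurable (lebesgue_on \<Omega>)"
    by (intro measurable_restrict_space1 lebesgue_measurable_reflect measurable_completion) (use J' in simp)
  show "(\<lambda>y. J (x - y) * h y) \<in> borel_measurable (lebesgue_on \<Omega>)"
    "(\<lambda>y. J' (x - y) * h y) \<in> borel_measurable (lebesgue_on \<Omega>)" by measurable
  have "AE y in lebesgue. J (x - y) = J' (x - y)"
    by (rule AE_completion[OF AE_lborel_reflect[OF ae]])
  then show "AE y in lebesgue_on \<Omega>. J (x - y) * h y = J' (x - y) * h y"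
    using \<Omega> by (subst AE_restrict_space_iff) (auto elim: eventually_mono)
qed

lemma measure_lebesgue_on_space:
  "\<Omega> \<in> sets lebesgue \<Longrightarrow> measure (lebesgue_on \<Omega>) (space (lebesgue_on \<Omega>)) = measure lebesgue \<Omega>"
  by (simp add: measure_restrict_space)

lemma measure_lebesgue_open_pos:
  assumes "open U" "bounded U" "U \<noteq> {}"
  shows "0 < measure lebesgue U"
proof -
  have "measure lebesgue U \<noteq> 0"
    using open_not_negligible[OF assms(1,3)] lmeasurable_open[OF assms(2,1)]
    by (simp add: negligible_iff_measure)
  then show ?thesis using measure_nonneg[of lebesgue U] by linarith
qed

text \<open>The solution is only Lebesgue measurable in \<open>(t, x)\<close>, that is, with respect to a completed
  product measure, to which Fubini's theorem does not apply; a Borel function \<open>v\<close> agreeing with it almost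
  everywhere takes its place.\<close>

lemma nl_solution_imp_evolution:
  fixes J :: "'a::euclidean_space \<Rightarrow> real"
  assumes \<Omega>: "open \<Omega>" "\<Omega> \<in> lmeasurable" and J: "J \<in> borel_measurable lebesgue"
    and J': "J' \<in> borel_measurable borel" "AE x in lborel. J x = J' x"
    and kernel: "nonlocal_kernel (lebesgue_on \<Omega>) (\<lambda>x y. J' (x - y))"
    and u0: "L2_on \<Omega> u0" and u: "nl_solution J \<Omega> u0 u"
  obtains v where "nonlocal_evolution (lebesgue_on \<Omega>) (\<lambda>x y. J' (x - y)) u v u0"
proof -
  let ?M = "lebesgue_on \<Omega>"
  interpret nonlocal_kernel ?M "\<lambda>x y. J' (x - y)" by fact
  interpret LM: pair_sigma_finite lborel ?M ..
  have u_L2: "\<And>t. 0 \<le> t \<Longrightarrow> sq_int ?M (u t)"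
    and u_cont: "\<And>t. 0 \<le> t \<Longrightarrow> ((\<lambda>s. nsq ?M (\<lambda>x. u s x - u t x)) \<longlongrightarrow> 0) (at t within {0..})"
    and u_joint: "(\<lambda>p. u (fst p) (snd p)) \<in> borel_measurable (lebesgue_on ({0..} \<times> \<Omega>))"
    and u_mild: "\<And>t. 0 \<le> t \<Longrightarrow> AE x in ?M.
        set_integrable lborel {0..t} (\<lambda>s. LINT y|?M. J (x - y) * (u s y - u s x)) \<and>
        u t x = u0 x + (LINT s:{0..t}|lborel. (LINT y|?M. J (x - y) * (u s y - u s x)))"
    using u by (auto simp: nl_solution_def L2_on_def sq_int_def nsq_def elim!: eventually_mono)
  have S: "({0..} \<times> \<Omega>) \<in> sets (lebesgue :: (real \<times> 'a) measure)"
    using \<Omega>(1) by (intro sets_completionI_sets) (simp add: borel_Times)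
  \<comment> \<open>Extension by zero moves \<open>u\<close> to the whole space, where a Lebesgue
    measurable function has a Borel version.\<close>
  have "(\<lambda>p. indicator ({0..} \<times> \<Omega>) p *\<^sub>R u (fst p) (snd p)) \<in> borel_measurable lebesgue"
    using u_joint S by (subst (asm) borel_measurable_restrict_space_iff) auto
  then obtain w where w: "w \<in> borel_measurable lborel"
      "AE p in lborel. indicator ({0..} \<times> \<Omega>) p *\<^sub>R u (fst p) (snd p) = w p"
    using completion_ex_borel_measurable_real by blast
  then obtain N where N: "N \<in> null_sets lborel"
      "\<And>p. p \<notin> N \<Longrightarrow> indicator ({0..} \<times> \<Omega>) p *\<^sub>R u (fst p) (snd p) = w p"
    by (auto elim!: AE_E3)
  define v where "v s x = w (s, x)" for s x
  have v_eq: "u s x = v s x" if "0 \<le> s" "x \<in> \<Omega>" "(s, x) \<notin> N" for s x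
    using N(2)[OF that(3)] that by (simp add: v_def)
  \<comment> \<open>Through this map Borel functions and Borel sets of pairs become measurable for
    the product of \<open>lborel\<close> and \<open>?M\<close>.\<close>
  have id: "(\<lambda>p. p) \<in> lborel \<Otimes>\<^sub>M ?M \<rightarrow>\<^sub>M (borel :: (real \<times> 'a) measure)"
  proof -
    have "(\<lambda>p. (fst p, snd p)) \<in> lborel \<Otimes>\<^sub>M ?M \<rightarrow>\<^sub>M (borel :: (real \<times> 'a) measure)"
    proof (rule borel_measurable_Pair)
      show "fst \<in> borel_measurable (lborel \<Otimes>\<^sub>M ?M)"
        using measurable_fst[of lborel ?M] by simp
      show "snd \<in> borel_measurable (lborel \<Otimes>\<^sub>M ?M)"
        using measurable_compose[OF measurable_snd id_borel_measurable_lebesgue_on[of \<Omega>], of lborel]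
        by (simp add: id_def)
    qed
    then show ?thesis by simp
  qed
  have v_meas: "case_prod v \<in> borel_measurable (lborel \<Otimes>\<^sub>M ?M)"
  proof -
    have "w \<in> borel_measurable borel" using w(1) by simp
    from measurable_compose[OF id this] show ?thesis
      by (rule back_subst[where P = "\<lambda>f. f \<in> borel_measurable (lborel \<Otimes>\<^sub>M ?M)"]) (auto simp: v_def)
  qed
  have "AE p in lborel \<Otimes>\<^sub>M lborel. p \<notin> N"
    unfolding lborel_prod using N(1) by (rule AE_not_in)
  then have "AE s in lborel. AE x in lborel. (s, x) \<notin> N"
    by (rule lborel_pair.AE_pair)
  then have N1: "AE s in lborel. AE x in ?M. (s, x) \<notin> N"
  proof eventually_elim
    case (elim s)
    from AE_completion[OF this] show ?case
      using \<Omega>(2) by (subst AE_restrict_space_iff) (auto elim: eventually_mono)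
  qed
  \<comment> \<open>Measurability of the complement of \<open>N\<close> allows the two
    almost-everywhere quantifiers to be exchanged.\<close>
  have "{p \<in> space (lborel \<Otimes>\<^sub>M ?M). (fst p, snd p) \<notin> N} \<in> sets (lborel \<Otimes>\<^sub>M ?M)"
  proof -
    have "- N \<in> sets borel" using N(1) by auto
    from measurable_sets[OF id this] show ?thesis
      by (simp add: vimage_def Int_def conj_commute)
  qed
  from LM.AE_commute[OF this] N1 have N2: "AE x in ?M. AE s in lborel. (s, x) \<notin> N"
    by simp
  have "nonlocal_evolution ?M (\<lambda>x y. J' (x - y)) u v u0"
  proof
    show "AE s in lborel. 0 \<le> s \<longrightarrow> (AE x in ?M. u s x = v s x)"
      using N1
    proof eventually_elim
      case (elim s)
      have "AE x in ?M. u s x = v s x" if "0 \<le> s"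
        using elim AE_space by eventually_elim (use that in \<open>auto intro: v_eq\<close>)
      then show ?case by blast
    qed
    fix t :: real assume t: "0 \<le> t"
    show "AE x in ?M. u t x = u0 x + (LINT s:{0..t}|lborel. nl_op (v s) x)"
      using u_mild[OF t] N2 AE_space
    proof eventually_elim
      case (elim x)
      have "(LINT s:{0..t}|lborel. (LINT y|?M. J (x - y) * (u s y - u s x))) = (LINT s:{0..t}|lborel. nl_op (v s) x)"
        unfolding set_lebesgue_integral_def
      proof (rule integral_cong_AE)
        show "(\<lambda>s. indicator {0..t} s *\<^sub>R (LINT y|?M. J (x - y) * (u s y - u s x))) \<in> borel_measurable lborel"
          using elim by (auto simp: set_integrable_def)
        have [measurable]: "(\<lambda>s. nl_op (v s) x) \<in> borel_measurable lborel"
          using measurable_compose[OF measurable_Pair2'[of x ?M lborel] nl_op_measurable[OF v_meas]] elim by simp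
        show "(\<lambda>s. indicator {0..t} s *\<^sub>R nl_op (v s) x) \<in> borel_measurable lborel"
          by measurable
        \<comment> \<open>Both slicings of \<open>N\<close> enter: \<open>N1\<close> gives equality
          of \<open>u s\<close> and \<open>v s\<close> at almost every y, and the slice at x gives
          it at the point x itself. These are the two inputs of
          \<open>nl_op_cong_AE\<close>.\<close>
        show "AE s in lborel. indicator {0..t} s *\<^sub>R (LINT y|?M. J (x - y) * (u s y - u s x))
            = indicator {0..t} s *\<^sub>R nl_op (v s) x"
          using N1 elim(2)
        proof eventually_elim
          case s: (elim s)
          have "(LINT y|?M. J (x - y) * (u s y - u s x)) = nl_op (v s) x" if "s \<in> {0..t}"
          proof -
            have s0: "0 \<le> s" using that by simp
            note [measurable] = sq_int_measurable[OF u_L2[OF s0]]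
            have [measurable]: "v s \<in> borel_measurable ?M"
              using measurable_compose[OF measurable_Pair1' v_meas] by simp
            have "(LINT y|?M. J (x - y) * (u s y - u s x)) = nl_op (u s) x"
              unfolding nl_op_def by (rule integral_AE_eq_kernel[OF \<Omega>(2) J J']) measurable
            also have "\<dots> = nl_op (v s) x"
            proof (rule nl_op_cong_AE)
              show "AE y in ?M. u s y = v s y"
                using s(1) AE_space by eventually_elim (use s0 in \<open>auto intro: v_eq\<close>)
              show "u s x = v s x" using s(2) s0 elim by (auto intro: v_eq)
            qed (use elim in auto)
            finally show ?thesis .
          qed
          then show ?case by (auto simp: indicator_def)
        qed
      qed
      then show ?case using elim by simp
    qed
  qed (use u_L2 u_cont u0 v_meas in \<open>auto simp: L2_on_def sq_int_def\<close>)
  then show thesis by (rule that)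
qed

section \<open>Positivity of \<beta> and assembly of the decay estimate\<close>

theorem theorem3p5:
  fixes \<Omega> :: "'a::euclidean_space set" and J :: "'a \<Rightarrow> real" and d :: real
  assumes "smooth_bounded_domain \<Omega>"
    and "kernel_J J d"
    and "integrable lebesgue (\<lambda>x. (J x)\<^sup>2)"
  shows "0 < nl_beta J \<Omega> \<and>
    (\<forall>u0 u. L2_on \<Omega> u0 \<and> nl_solution J \<Omega> u0 u \<longrightarrow>
       (\<forall>t\<ge>0. (LINT x|lebesgue_on \<Omega>. (u t x - mean_on \<Omega> u0)\<^sup>2)
               \<le> exp (- nl_beta J \<Omega> * t) * (LINT x|lebesgue_on \<Omega>. (u0 x - mean_on \<Omega> u0)\<^sup>2)))"
proof -
  let ?M = "lebesgue_on \<Omega>"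
  note dom = smooth_bounded_domainD[OF assms(1)]
  have lm: "\<Omega> \<in> lmeasurable" using dom by (intro lmeasurable_open)
  have J: "J \<in> borel_measurable lebesgue" using assms(2) by (simp add: kernel_J_def)
  obtain c J' where d: "0 < d" and c: "0 < c" and J': "J' \<in> borel_measurable borel" "AE x in lborel. J x = J' x"
    and J'_nn: "\<And>x. 0 \<le> J' x" and J'_sym: "\<And>x. J' (- x) = J' x"
    and J'_mass: "(\<integral>\<^sup>+x. ennreal (J' x) \<partial>lborel) = 1" and J'_low: "\<And>x. norm x < d / 2 \<Longrightarrow> c \<le> J' x"
    by (rule kernel_J_Borel_version[OF assms(2)]) blast
  have kernel: "nonlocal_kernel ?M (\<lambda>x y. J' (x - y))"
    by (rule convolution_kernel[OF lm J'(1) J'_nn J'_sym J'_mass])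
  interpret nonlocal_kernel ?M "\<lambda>x y. J' (x - y)" by (rule kernel)
  have mean: "mean_on \<Omega> f = (LINT x|?M. f x) / measure ?M (space ?M)" for f
    using measure_lebesgue_on_space[of \<Omega>] lm by (simp add: mean_on_def)
  have pos: "0 < measure ?M (space ?M)"
    using measure_lebesgue_open_pos[OF dom(1,2,4)] measure_lebesgue_on_space[of \<Omega>] lm by simp
  \<comment> \<open>The radius r = d / 6 is chosen so that 3 * r = d / 2, the range on which J' is
    at least c.\<close>
  obtain C where C: "0 < C" "\<And>f. sq_int ?M f \<Longrightarrow> nsq ?M (\<lambda>x. f x - mean_on \<Omega> f) \<le> C * form f f"
  proof (rule nonlocal_Poincare[OF kernel, where r = "d / 6" and c = c])
    show "bounded (space ?M)" "connected (space ?M)" "space ?M \<noteq> {}" "0 < d / 6" "0 < c"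
      using dom d c by simp_all
    show "c \<le> J' (x - y)" if "dist x y < 3 * (d / 6)" for x y
      using that by (intro J'_low) (simp add: dist_norm)
    show "ball x (d / 6) \<inter> space ?M \<in> sets ?M \<and> 0 < measure ?M (ball x (d / 6) \<inter> space ?M)"
      if "x \<in> space ?M" for x
    proof -
      have "x \<in> ball x (d / 6) \<inter> \<Omega>" using d that by simp
      then have U: "open (ball x (d / 6) \<inter> \<Omega>)" "bounded (ball x (d / 6) \<inter> \<Omega>)" "ball x (d / 6) \<inter> \<Omega> \<noteq> {}"
        using dom by (blast intro: open_Int bounded_Int)+
      from measure_lebesgue_open_pos[OF this] lmeasurable_open[OF U(2,1)] lm show ?thesis
        by (auto simp: sets_restrict_space_iff measure_restrict_space)
    qed
  qed (use mean in auto)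
  define nonconst where "nonconst f \<longleftrightarrow> L2_on \<Omega> f \<and> \<not> (\<exists>c. AE x in ?M. f x = c)" for f
  \<comment> \<open>The inner integral is the same for J and J' at every x, so the numerator in
    \<beta> is the form of the Borel kernel.\<close>
  have form_eq: "(LINT x|?M. LINT y|?M. J (x - y) * (f y - f x)\<^sup>2) = form f f" if f: "sq_int ?M f" for f
  proof -
    note [measurable] = sq_int_measurable[OF f]
    show ?thesis
      unfolding form_iterated[OF f f] power2_eq_square
      by (intro Bochner_Integration.integral_cong refl integral_AE_eq_kernel[OF lm J J']) measurable
  qed
  have beta: "nl_beta J \<Omega> = Inf ((\<lambda>f. form f f / nsq ?M (\<lambda>x. f x - mean_on \<Omega> f)) ` Collect nonconst)"
    unfolding nl_beta_def setcompr_eq_image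
    by (intro arg_cong[where f = Inf] image_cong)
      (auto simp: nonconst_def L2_on_def nsq_def sq_int_def form_eq)
  have L2: "sq_int ?M f \<longleftrightarrow> L2_on \<Omega> f" for f by (simp add: sq_int_def L2_on_def)
  have nsq_pos: "0 < nsq ?M (\<lambda>x. f x - mean_on \<Omega> f)" if "nonconst f" for f
  proof -
    have f: "sq_int ?M (\<lambda>x. f x - mean_on \<Omega> f)"
      using that by (intro sq_int_diff sq_int_const) (simp add: nonconst_def L2)
    have "\<not> (AE x in ?M. (f x - mean_on \<Omega> f)\<^sup>2 = 0)"
      using that by (auto simp: nonconst_def)
    then have "nsq ?M (\<lambda>x. f x - mean_on \<Omega> f) \<noteq> 0"
      unfolding nsq_def by (subst integral_nonneg_eq_0_iff_AE) (use sq_int_integrable[OF f] in auto)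
    then show ?thesis using nsq_nonneg[of ?M "\<lambda>x. f x - mean_on \<Omega> f"] by linarith
  qed
  \<comment> \<open>A coordinate function shows that the infimum runs over a nonempty set: it is
    bounded on the domain, and its level sets are null hyperplanes, which cannot fill a nonempty
    open set up to a null set.\<close>
  obtain b :: 'a where b: "b \<in> Basis" using nonempty_Basis by blast
  have "nonconst (\<lambda>x. x \<bullet> b)"
    unfolding nonconst_def
  proof
    have meas: "(\<lambda>x. x \<bullet> b) \<in> borel_measurable ?M"
      using id_borel_measurable_lebesgue_on[of \<Omega>] by (simp add: id_def)
    obtain B where B: "\<And>x. x \<in> \<Omega> \<Longrightarrow> norm x \<le> B"
      using dom(2) by (auto simp: bounded_iff)
    have "integrable ?M (\<lambda>x. (x \<bullet> b)\<^sup>2)"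
    proof (rule integrable_const_bound[where B = "B\<^sup>2"])
      show "AE x in ?M. norm ((x \<bullet> b)\<^sup>2) \<le> B\<^sup>2"
      proof (rule AE_I2)
        fix x assume "x \<in> space ?M"
        then have "\<bar>x \<bullet> b\<bar> \<le> \<bar>B\<bar>"
          using B[of x] Basis_le_norm[OF b, of x] by auto
        then show "norm ((x \<bullet> b)\<^sup>2) \<le> B\<^sup>2" by (simp add: abs_le_square_iff)
      qed
    qed (use meas in measurable)
    then show "L2_on \<Omega> (\<lambda>x. x \<bullet> b)" using meas by (simp add: L2_on_def)
    show "\<not> (\<exists>c. AE x in ?M. x \<bullet> b = c)"
    proof
      assume "\<exists>c. AE x in ?M. x \<bullet> b = c"
      then obtain c where "AE x in lebesgue. x \<in> \<Omega> \<longrightarrow> x \<bullet> b = c"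
        using lm by (auto simp: AE_restrict_space_iff)
      then obtain N where "negligible N" "{x. \<not> (x \<in> \<Omega> \<longrightarrow> x \<bullet> b = c)} \<subseteq> N"
        unfolding eventually_ae_filter_negligible by blast
      moreover have "negligible {x. x \<bullet> b = c}" by (rule negligible_standard_hyperplane[OF b])
      ultimately have "negligible (N \<union> {x. x \<bullet> b = c})" "\<Omega> \<subseteq> N \<union> {x. x \<bullet> b = c}"
        by auto
      then have "negligible \<Omega>" by (rule negligible_subset)
      then show False using open_not_negligible[OF dom(1,4)] by simp
    qed
  qed
  then have ne: "Collect nonconst \<noteq> {}" by auto
  have beta_pos: "0 < nl_beta J \<Omega>"
  proof -
    \<comment> \<open>The Poincare constant bounds every admissible quotient from below.\<close>
    have "1 / C \<le> nl_beta J \<Omega>"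
      unfolding beta
    proof (rule cInf_greatest)
      fix z assume "z \<in> (\<lambda>f. form f f / nsq ?M (\<lambda>x. f x - mean_on \<Omega> f)) ` Collect nonconst"
      then obtain f where f: "nonconst f" "z = form f f / nsq ?M (\<lambda>x. f x - mean_on \<Omega> f)" by auto
      have "nsq ?M (\<lambda>x. f x - mean_on \<Omega> f) \<le> C * form f f"
        using f(1) by (intro C(2)) (simp add: nonconst_def L2)
      then show "1 / C \<le> z"
        unfolding f(2) using nsq_pos[OF f(1)] C(1) by (simp add: divide_le_eq le_divide_eq mult.commute)
    qed (use ne in simp)
    then show ?thesis using C(1) by (smt (verit) divide_pos_pos)
  qed
  \<comment> \<open>Functions that are constant almost everywhere are excluded from the infimum and
    treated apart: for them the left side is 0.\<close>
  have gap: "nl_beta J \<Omega> * nsq ?M (\<lambda>x. f x - mean_on \<Omega> f) \<le> form f f" if f: "sq_int ?M f" for f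
  proof (cases "nonconst f")
    case True
    have "nl_beta J \<Omega> \<le> form f f / nsq ?M (\<lambda>x. f x - mean_on \<Omega> f)"
      unfolding beta
    proof (rule cInf_lower)
      show "bdd_below ((\<lambda>f. form f f / nsq ?M (\<lambda>x. f x - mean_on \<Omega> f)) ` Collect nonconst)"
        by (rule bdd_belowI[of _ 0]) (auto simp: form_nonneg)
    qed (use True in auto)
    then show ?thesis using nsq_pos[OF True] by (simp add: field_simps)
  next
    case False
    then obtain a where a: "AE x in ?M. f x = a"
      using f by (auto simp: nonconst_def L2)
    have "(LINT x|?M. f x) = (LINT x|?M. a)"
      using a sq_int_measurable[OF f] by (intro integral_cong_AE) auto
    then have "mean_on \<Omega> f = a" using pos by (simp add: mean)
    then have "nsq ?M (\<lambda>x. f x - mean_on \<Omega> f) = 0"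
      unfolding nsq_def using a by (intro integral_eq_zero_AE) (auto elim: eventually_mono)
    then show ?thesis using form_nonneg by simp
  qed
  have "(LINT x|?M. (u t x - mean_on \<Omega> u0)\<^sup>2)
      \<le> exp (- nl_beta J \<Omega> * t) * (LINT x|?M. (u0 x - mean_on \<Omega> u0)\<^sup>2)"
    if u0: "L2_on \<Omega> u0" and u: "nl_solution J \<Omega> u0 u" and t: "0 \<le> t" for u0 u t
  proof -
    obtain v where "nonlocal_evolution ?M (\<lambda>x y. J' (x - y)) u v u0"
      using nl_solution_imp_evolution[OF dom(1) lm J J' kernel u0 u] .
    then interpret nonlocal_evolution ?M "\<lambda>x y. J' (x - y)" u v u0 .
    show ?thesis
      using exponential_decay[OF gap[unfolded mean] t mean] by (simp add: nsq_def)
  qed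
  then show ?thesis using beta_pos by blast
qed

end
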